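(* Every finite distributive lattice $D$ can be represented as the congruence lattice of a rectangular lattice $K$ with the property that all congruences of $K$ are principal; that is, for every finite distributive lattice $D$ there exists a rectangular lattice $K$ such that the congruence lattice $\operatorname{Con} K$ is isomorphic to $D$ and every congruence of $K$ is principal.
   Context: A planar lattice is a finite lattice that has a planar Hasse diagram; a fixed planar diagram is understood, and the left and right boundaries are taken with respect to it. A finite lattice is semimodular if $a \wedge b \prec a$ implies $b \prec a \vee b$ (where $\prec$ denotes the covering relation). A left corner (resp. right corner) of a planar lattice $L$ is a doubly-irreducible element (both join-irreducible and meet-irreducible) of $L \setminus \{0,1\}$ lying on the left (resp. right) boundary of $L$. A rectangular lattice is a planar semimodular lattice $L$ that has exactly one left corner, $\mathrm{lc}(L)$, and exactly one right corner, $\mathrm{rc}(L)$, and these are complementary: $\mathrm{lc}(L) \vee \mathrm{rc}(L) = 1$ and $\mathrm{lc}(L) \wedge \mathrm{rc}(L) = 0$. A congruence of a lattice $K$ is principal if it is of the form $\operatorname{con}(a,b)$ for some $a,b \in K$, i.e. it is the smallest congruence of $K$ collapsing the pair $a,b$ (the choice $a=b$ gives the identity congruence).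
   Formalization: The finite distributive lattice D is assumed to have at least two elements; for one-element D the claim fails, since Con K trivial forces K to have one element, and then K has no corners and is not rectangular. *)

theory Defs
  imports "HOL-Analysis.Analysis" "HOL-Algebra.Lattice"
begin

definition finite_lattice :: "('a, 'b) gorder_scheme \<Rightarrow> bool" where
  "finite_lattice L \<longleftrightarrow> lattice L \<and> finite (carrier L) \<and> carrier L \<noteq> {}"

definition distributive :: "('a, 'b) gorder_scheme \<Rightarrow> bool" where
  "distributive L \<longleftrightarrow>
     (\<forall>x\<in>carrier L. \<forall>y\<in>carrier L. \<forall>z\<in>carrier L.
        x \<sqinter>\<^bsub>L\<^esub> (y \<squnion>\<^bsub>L\<^esub> z) = (x \<sqinter>\<^bsub>L\<^esub> y) \<squnion>\<^bsub>L\<^esub> (x \<sqinter>\<^bsub>L\<^esub> z))"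

definition lattice_isomorphic ::
    "('a, 'c) gorder_scheme \<Rightarrow> ('b, 'd) gorder_scheme \<Rightarrow> bool" where
  "lattice_isomorphic L M \<longleftrightarrow>
     (\<exists>f. bij_betw f (carrier L) (carrier M) \<and> join_pres L M f \<and> meet_pres L M f)"


section \<open>Covering and semimodularity\<close>

definition covered_by :: "('a, 'b) gorder_scheme \<Rightarrow> 'a \<Rightarrow> 'a \<Rightarrow> bool" where
  "covered_by L a b \<longleftrightarrow>
     a \<in> carrier L \<and> b \<in> carrier L \<and> a \<sqsubset>\<^bsub>L\<^esub> b \<and>
     \<not> (\<exists>c\<in>carrier L. a \<sqsubset>\<^bsub>L\<^esub> c \<and> c \<sqsubset>\<^bsub>L\<^esub> b)"

definition semimodular :: "('a, 'b) gorder_scheme \<Rightarrow> bool" where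
  "semimodular L \<longleftrightarrow>
     (\<forall>a\<in>carrier L. \<forall>b\<in>carrier L.
        covered_by L (a \<sqinter>\<^bsub>L\<^esub> b) a \<longrightarrow> covered_by L b (a \<squnion>\<^bsub>L\<^esub> b))"

definition join_irreducible :: "('a, 'b) gorder_scheme \<Rightarrow> 'a \<Rightarrow> bool" where
  "join_irreducible L a \<longleftrightarrow>
     a \<in> carrier L \<and> a \<noteq> \<bottom>\<^bsub>L\<^esub> \<and>
     (\<forall>b\<in>carrier L. \<forall>c\<in>carrier L. a = b \<squnion>\<^bsub>L\<^esub> c \<longrightarrow> a = b \<or> a = c)"

definition meet_irreducible :: "('a, 'b) gorder_scheme \<Rightarrow> 'a \<Rightarrow> bool" where
  "meet_irreducible L a \<longleftrightarrow>
     a \<in> carrier L \<and> a \<noteq> \<top>\<^bsub>L\<^esub> \<and>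
     (\<forall>b\<in>carrier L. \<forall>c\<in>carrier L. a = b \<sqinter>\<^bsub>L\<^esub> c \<longrightarrow> a = b \<or> a = c)"


section \<open>Planar diagrams\<close>

text \<open>
  A diagram is given by the positions \<open>p\<close> of the elements in the plane; each covering
  pair is drawn as a straight line segment going strictly upwards. In a planar diagram no
  segment passes through an element other than its two ends, and two different segments
  meet at most in a common end.
\<close>

definition planar_diagram :: "('a, 'b) gorder_scheme \<Rightarrow> ('a \<Rightarrow> real \<times> real) \<Rightarrow> bool" where
  "planar_diagram L p \<longleftrightarrow>
     inj_on p (carrier L) \<and>
     (\<forall>a b. covered_by L a b \<longrightarrow> snd (p a) < snd (p b)) \<and>
     (\<forall>a b. \<forall>c\<in>carrier L. covered_by L a b \<and> p c \<in> closed_segment (p a) (p b)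
        \<longrightarrow> c = a \<or> c = b) \<and>
     (\<forall>a b c d. covered_by L a b \<and> covered_by L c d \<and> (a, b) \<noteq> (c, d)
        \<longrightarrow> closed_segment (p a) (p b) \<inter> closed_segment (p c) (p d) \<subseteq> p ` ({a, b} \<inter> {c, d}))"

definition diagram_points :: "('a, 'b) gorder_scheme \<Rightarrow> ('a \<Rightarrow> real \<times> real) \<Rightarrow> (real \<times> real) set" where
  "diagram_points L p =
     p ` carrier L \<union> (\<Union>(a, b)\<in>{(a, b). covered_by L a b}. closed_segment (p a) (p b))"

text \<open>
  An element lies on the left (right) boundary if no point of the diagram, whether an
  element or a point of an edge, lies strictly to the left (right) of it at the same height.
\<close>

definition left_boundary :: "('a, 'b) gorder_scheme \<Rightarrow> ('a \<Rightarrow> real \<times> real) \<Rightarrow> 'a set" where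
  "left_boundary L p =
     {a \<in> carrier L. \<forall>q\<in>diagram_points L p. snd q = snd (p a) \<longrightarrow> fst (p a) \<le> fst q}"

definition right_boundary :: "('a, 'b) gorder_scheme \<Rightarrow> ('a \<Rightarrow> real \<times> real) \<Rightarrow> 'a set" where
  "right_boundary L p =
     {a \<in> carrier L. \<forall>q\<in>diagram_points L p. snd q = snd (p a) \<longrightarrow> fst q \<le> fst (p a)}"


section \<open>Rectangular lattices\<close>

definition left_corner :: "('a, 'b) gorder_scheme \<Rightarrow> ('a \<Rightarrow> real \<times> real) \<Rightarrow> 'a \<Rightarrow> bool" where
  "left_corner L p a \<longleftrightarrow>
     a \<in> carrier L - {\<bottom>\<^bsub>L\<^esub>, \<top>\<^bsub>L\<^esub>} \<and> join_irreducible L a \<and> meet_irreducible L a \<and>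
     a \<in> left_boundary L p"

definition right_corner :: "('a, 'b) gorder_scheme \<Rightarrow> ('a \<Rightarrow> real \<times> real) \<Rightarrow> 'a \<Rightarrow> bool" where
  "right_corner L p a \<longleftrightarrow>
     a \<in> carrier L - {\<bottom>\<^bsub>L\<^esub>, \<top>\<^bsub>L\<^esub>} \<and> join_irreducible L a \<and> meet_irreducible L a \<and>
     a \<in> right_boundary L p"

definition lc :: "('a, 'b) gorder_scheme \<Rightarrow> ('a \<Rightarrow> real \<times> real) \<Rightarrow> 'a" where
  "lc L p = (THE a. left_corner L p a)"

definition rc :: "('a, 'b) gorder_scheme \<Rightarrow> ('a \<Rightarrow> real \<times> real) \<Rightarrow> 'a" where
  "rc L p = (THE a. right_corner L p a)"

definition rectangular_lattice :: "('a, 'b) gorder_scheme \<Rightarrow> ('a \<Rightarrow> real \<times> real) \<Rightarrow> bool" where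
  "rectangular_lattice L p \<longleftrightarrow>
     finite_lattice L \<and> planar_diagram L p \<and> semimodular L \<and>
     (\<exists>!a. left_corner L p a) \<and> (\<exists>!a. right_corner L p a) \<and>
     lc L p \<squnion>\<^bsub>L\<^esub> rc L p = \<top>\<^bsub>L\<^esub> \<and> lc L p \<sqinter>\<^bsub>L\<^esub> rc L p = \<bottom>\<^bsub>L\<^esub>"


section \<open>Congruences\<close>

definition lattice_congruence :: "('a, 'b) gorder_scheme \<Rightarrow> ('a \<times> 'a) set \<Rightarrow> bool" where
  "lattice_congruence L \<theta> \<longleftrightarrow>
     equiv (carrier L) \<theta> \<and>
     (\<forall>a b c d. (a, b) \<in> \<theta> \<and> (c, d) \<in> \<theta>
        \<longrightarrow> (a \<squnion>\<^bsub>L\<^esub> c, b \<squnion>\<^bsub>L\<^esub> d) \<in> \<theta> \<and> (a \<sqinter>\<^bsub>L\<^esub> c, b \<sqinter>\<^bsub>L\<^esub> d) \<in> \<theta>)"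

definition Con :: "('a, 'b) gorder_scheme \<Rightarrow> ('a \<times> 'a) set gorder" where
  "Con L = \<lparr>carrier = {\<theta>. lattice_congruence L \<theta>}, eq = (=), le = (\<subseteq>)\<rparr>"

definition con :: "('a, 'b) gorder_scheme \<Rightarrow> 'a \<Rightarrow> 'a \<Rightarrow> ('a \<times> 'a) set" where
  "con L a b = \<Inter>{\<theta>. lattice_congruence L \<theta> \<and> (a, b) \<in> \<theta>}"

definition principal_congruence :: "('a, 'b) gorder_scheme \<Rightarrow> ('a \<times> 'a) set \<Rightarrow> bool" where
  "principal_congruence L \<theta> \<longleftrightarrow> (\<exists>a\<in>carrier L. \<exists>b\<in>carrier L. \<theta> = con L a b)"

end

theory Submission
  imports Defs
begin

text \<open>
  The lattice is carved out of a square grid whose two axes carry the same colouring of their edges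
  by the join-irreducible elements of \<open>D\<close>. Two kinds of modifications are made. An \<^emph>\<open>eye\<close> is a third
  atom added to a grid cell, turning it into \<open>M\<^sub>3\<close>; it forces the two edges on which the cell projects
  to be collapsed together, and is placed only in cells whose two edges have equal colours. A
  \<^emph>\<open>fork\<close> at \<open>k\<close> cuts the column \<open>k\<close> off above the row \<open>k\<close> and the row \<open>k\<close> off to the right of the
  column \<open>k\<close>; collapsing the edge \<open>[k - 1, k]\<close> then forces collapsing \<open>[k, k + 1]\<close>. Hence congruences
  correspond to the sets of colours closed under the forks, that is, to the down-sets of
  join-irreducible elements, and these are the elements of \<open>D\<close> by Birkhoff's theorem. A
  congruence is principal as soon as its colours are exactly those of an interval of the axis, so a
  stretch of the axis is reserved for a word having every set of colours as a factor.
\<close>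

section \<open>Joins, meets and order isomorphisms\<close>

text \<open>The two modifications are kept apart. Forks delete only points with both coordinates
  positive, while eyes go only into cells with a negative coordinate; so a cell with an eye keeps
  its four corners, and an edge of nonnegative index is still tied by an eye to a negative edge of
  the same colour on the other axis. A fork acts in one direction because deletion disturbs joins
  only: grid points are closed under componentwise minimum, but a maximum that falls on a deleted
  point is rounded up by one step in one coordinate. This rounding carries a collapse from
  \<open>[k - 1, k]\<close> to \<open>[k, k + 1]\<close>, and its compatibility with closed sets of
  colours is the crux in showing that the candidate relations are congruences. For planarity it is
  enough to embed the order into the product order of the plane. Eyes are doubly irreducible, so
  uniqueness of the corners depends on eyes being drawn strictly inside the diagram.\<close>

lemma least_UpperI2:
  assumes "s \<in> carrier L" "x \<sqsubseteq>\<^bsub>L\<^esub> s" "y \<sqsubseteq>\<^bsub>L\<^esub> s"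
    and "\<And>z. \<lbrakk>z \<in> carrier L; x \<sqsubseteq>\<^bsub>L\<^esub> z; y \<sqsubseteq>\<^bsub>L\<^esub> z\<rbrakk> \<Longrightarrow> s \<sqsubseteq>\<^bsub>L\<^esub> z"
    and "x \<in> carrier L" "y \<in> carrier L"
  shows "least L s (Upper L {x, y})"
  using assms by (auto simp: least_def Upper_def)

lemma greatest_LowerI2:
  assumes "s \<in> carrier L" "s \<sqsubseteq>\<^bsub>L\<^esub> x" "s \<sqsubseteq>\<^bsub>L\<^esub> y"
    and "\<And>z. \<lbrakk>z \<in> carrier L; z \<sqsubseteq>\<^bsub>L\<^esub> x; z \<sqsubseteq>\<^bsub>L\<^esub> y\<rbrakk> \<Longrightarrow> z \<sqsubseteq>\<^bsub>L\<^esub> s"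
    and "x \<in> carrier L" "y \<in> carrier L"
  shows "greatest L s (Lower L {x, y})"
  using assms by (auto simp: greatest_def Lower_def)

lemma (in partial_order) join_eq_least:
  assumes "least L s (Upper L {x, y})"
  shows "x \<squnion> y = s"
  unfolding join_def sup_def
  by (rule some_equality, rule assms, rule least_unique[OF _ assms])

lemma (in partial_order) meet_eq_greatest:
  assumes "greatest L s (Lower L {x, y})"
  shows "x \<sqinter> y = s"
  unfolding meet_def inf_def
  by (rule some_equality, rule assms, rule greatest_unique[OF _ assms])

lemma (in partial_order) bottom_eqI:
  assumes "b \<in> carrier L" "\<And>x. x \<in> carrier L \<Longrightarrow> b \<sqsubseteq> x"
  shows "\<bottom> = b"
  unfolding bottom_def
  using assms least_unique by (intro some_equality) (auto simp: least_def)

lemma (in partial_order) top_eqI: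
  assumes "b \<in> carrier L" "\<And>x. x \<in> carrier L \<Longrightarrow> x \<sqsubseteq> b"
  shows "\<top> = b"
  unfolding top_def
  using assms greatest_unique by (intro some_equality) (auto simp: greatest_def)

text \<open>Only \<open>D\<close> is assumed to be a lattice: joins and meets of \<open>C\<close>
  are those of \<open>D\<close> carried over by \<open>h\<close>. For a congruence lattice this
  spares a separate description of joins.\<close>

lemma lattice_isomorphicI_order_iso:
  fixes C :: "('a, 'c) gorder_scheme" and D :: "('b, 'd) gorder_scheme"
  assumes C: "partial_order C" and D: "lattice D"
    and bij: "bij_betw h (carrier D) (carrier C)"
    and le: "\<And>x y. \<lbrakk>x \<in> carrier D; y \<in> carrier D\<rbrakk> \<Longrightarrow> h x \<sqsubseteq>\<^bsub>C\<^esub> h y \<longleftrightarrow> x \<sqsubseteq>\<^bsub>D\<^esub> y"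
  shows "lattice_isomorphic C D"
proof -
  interpret C: partial_order C by (rule C)
  interpret D: lattice D by (rule D)
  define f where "f = inv_into (carrier D) h"
  have bij': "bij_betw f (carrier C) (carrier D)"
    unfolding f_def by (rule bij_betw_inv_into[OF bij])
  have hf: "h (f x) = x" if "x \<in> carrier C" for x
    using bij_betw_inv_into_right[OF bij that] by (simp add: f_def)
  have fh: "f (h x) = x" if "x \<in> carrier D" for x
    using bij_betw_inv_into_left[OF bij that] by (simp add: f_def)
  have fc: "f x \<in> carrier D" if "x \<in> carrier C" for x
    using bij_betwE[OF bij'] that by blast
  have hc: "h x \<in> carrier C" if "x \<in> carrier D" for x
    using bij_betwE[OF bij] that by blast
  have le1: "x \<sqsubseteq>\<^bsub>C\<^esub> h y \<longleftrightarrow> f x \<sqsubseteq>\<^bsub>D\<^esub> y" if "x \<in> carrier C" "y \<in> carrier D" for x y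
    using le[of "f x" y] that hf fc by simp
  have le2: "h x \<sqsubseteq>\<^bsub>C\<^esub> y \<longleftrightarrow> x \<sqsubseteq>\<^bsub>D\<^esub> f y" if "x \<in> carrier D" "y \<in> carrier C" for x y
    using le[of x "f y"] that hf fc by simp
  have le3: "x \<sqsubseteq>\<^bsub>C\<^esub> y \<longleftrightarrow> f x \<sqsubseteq>\<^bsub>D\<^esub> f y" if "x \<in> carrier C" "y \<in> carrier C" for x y
    using le1[of x "f y"] that hf fc by simp
  have J: "least C (h (f x \<squnion>\<^bsub>D\<^esub> f y)) (Upper C {x, y})"
    if "x \<in> carrier C" "y \<in> carrier C" for x y
    using that by (intro least_UpperI2)
      (auto simp: le1 le2 le3 hc fc fh D.join_left D.join_right D.join_le)
  have M: "greatest C (h (f x \<sqinter>\<^bsub>D\<^esub> f y)) (Lower C {x, y})"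
    if "x \<in> carrier C" "y \<in> carrier C" for x y
    using that by (intro greatest_LowerI2)
      (auto simp: le1 le2 le3 hc fc fh D.meet_left D.meet_right D.meet_le)
  have latC: "lattice C"
    by unfold_locales (use J M in blast)+
  show ?thesis
    unfolding lattice_isomorphic_def join_pres_def meet_pres_def
    using bij' latC D C.join_eq_least[OF J] C.meet_eq_greatest[OF M]
    by (intro exI[of _ f]) (auto simp: fh fc)
qed

section \<open>Planarity from an order embedding into the plane\<close>

text \<open>Elements are drawn after a scaled turn by 45 degrees, so that growth in either
  coordinate goes upwards. Half-sum and half-difference undo the turn, and along a segment both
  recovered coordinates move linearly in one parameter.\<close>

lemma closed_segment_rotated:
  fixes a1 a2 b1 b2 :: real
  assumes "z \<in> closed_segment (a1 - a2, a1 + a2) (b1 - b2, b1 + b2)"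
  obtains u where "0 \<le> u" "u \<le> 1"
    "(snd z + fst z) / 2 = a1 + u * (b1 - a1)" "(snd z - fst z) / 2 = a2 + u * (b2 - a2)"
proof -
  from assms obtain u where u: "0 \<le> u" "u \<le> 1"
    and z: "z = (1 - u) *\<^sub>R (a1 - a2, a1 + a2) + u *\<^sub>R (b1 - b2, b1 + b2)"
    unfolding closed_segment_def by blast
  show ?thesis
    by (rule that[OF u]) (simp_all add: z field_simps)
qed

text \<open>
  If the segments of two coverings meet, each lower end lies below each upper end; the join of the
  lower ends then lies in both intervals and forces a common end.
\<close>

lemma planar_diagram_of_embedding:
  fixes L :: "('a, 'b) gorder_scheme" (structure) and X Y :: "'a \<Rightarrow> real"
  assumes "lattice L"
    and le: "\<And>a b. \<lbrakk>a \<in> carrier L; b \<in> carrier L\<rbrakk> \<Longrightarrow> a \<sqsubseteq>\<^bsub>L\<^esub> b \<longleftrightarrow> X a \<le> X b \<and> Y a \<le> Y b"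
  shows "planar_diagram L (\<lambda>a. (X a - Y a, X a + Y a))"
proof -
  interpret lattice L by fact
  let ?p = "\<lambda>a. (X a - Y a, X a + Y a)"
  have inj: "a = b" if "a \<in> carrier L" "b \<in> carrier L" "X a = X b" "Y a = Y b" for a b
    using that le by (intro le_antisym) auto
  have cov: "a \<in> carrier L \<and> b \<in> carrier L \<and> X a \<le> X b \<and> Y a \<le> Y b \<and> a \<noteq> b" if "covered_by L a b" for a b
    using that le by (auto simp: covered_by_def lless_def eq_is_equal)
  have between: "c = a \<or> c = b"
    if "covered_by L a b" "c \<in> carrier L" "a \<sqsubseteq> c" "c \<sqsubseteq> b" for a b c
    using that by (auto simp: covered_by_def lless_def eq_is_equal)
  have box: "X a \<le> (snd z + fst z) / 2 \<and> (snd z + fst z) / 2 \<le> X b \<and>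
      Y a \<le> (snd z - fst z) / 2 \<and> (snd z - fst z) / 2 \<le> Y b"
    if c1: "covered_by L a b" and z: "z \<in> closed_segment (?p a) (?p b)" for a b z
  proof -
    obtain u where "0 \<le> u" "u \<le> 1"
      "(snd z + fst z) / 2 = X a + u * (X b - X a)" "(snd z - fst z) / 2 = Y a + u * (Y b - Y a)"
      using closed_segment_rotated[OF z] .
    with cov[OF c1] show ?thesis
      using mult_left_le_one_le[of "X b - X a" u] mult_left_le_one_le[of "Y b - Y a" u] by auto
  qed
  have key0: "s \<le> t" if "u * s = v * t" "v \<le> u" "0 < v" "0 \<le> t" for s t u v :: real
  proof (rule ccontr)
    assume "\<not> s \<le> t"
    then have "v * t < v * s" using that by simp
    moreover have "v * s \<le> u * s" using that \<open>\<not> s \<le> t\<close> by (intro mult_right_mono) auto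
    ultimately show False using that(1) by linarith
  qed
  \<comment> \<open>Two edges from \<open>a\<close> that meet again have the same direction. The one
    needing the larger parameter to reach \<open>z\<close> is shorter in both coordinates, so its
    upper end lies in the interval of the other covering.\<close>
  have lower: "z = ?p a \<or> b = d"
    if c1: "covered_by L a b" and c2: "covered_by L a d" and z1: "z \<in> closed_segment (?p a) (?p b)"
      and z2: "z \<in> closed_segment (?p a) (?p d)" for a b d z
  proof -
    obtain u where u: "0 \<le> u" "u \<le> 1"
      "(snd z + fst z) / 2 = X a + u * (X b - X a)" "(snd z - fst z) / 2 = Y a + u * (Y b - Y a)"
      using closed_segment_rotated[OF z1] .
    obtain v where v: "0 \<le> v" "v \<le> 1"
      "(snd z + fst z) / 2 = X a + v * (X d - X a)" "(snd z - fst z) / 2 = Y a + v * (Y d - Y a)"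
      using closed_segment_rotated[OF z2] .
    have eqs: "u * (X b - X a) = v * (X d - X a)" "u * (Y b - Y a) = v * (Y d - Y a)"
      using u v by linarith+
    consider "u = 0" | "v = 0" | "0 < u" "0 < v" "u \<le> v" | "0 < u" "0 < v" "v \<le> u"
      using u v by linarith
    then show ?thesis
    proof cases
      case 1
      have "fst z = X a - Y a" "snd z = X a + Y a" using u 1 by (auto simp: field_simps)
      then show ?thesis by (simp add: prod_eq_iff)
    next
      case 2
      have "fst z = X a - Y a" "snd z = X a + Y a" using v 2 by (auto simp: field_simps)
      then show ?thesis by (simp add: prod_eq_iff)
    next
      case 3
      have "X d - X a \<le> X b - X a" "Y d - Y a \<le> Y b - Y a"
        using key0[OF eqs(1)[symmetric]] key0[OF eqs(2)[symmetric]] 3 cov[OF c1] by simp_all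
      then have "d \<sqsubseteq> b" "a \<sqsubseteq> d" using le cov[OF c1] cov[OF c2] by auto
      then show ?thesis using between[OF c1] cov[OF c2] by blast
    next
      case 4
      have "X b - X a \<le> X d - X a" "Y b - Y a \<le> Y d - Y a"
        using key0[OF eqs(1)] key0[OF eqs(2)] 4 cov[OF c2] by simp_all
      then have "b \<sqsubseteq> d" "a \<sqsubseteq> b" using le cov[OF c1] cov[OF c2] by auto
      then show ?thesis using between[OF c2] cov[OF c1] by blast
    qed
  qed
  have upper: "z = ?p b \<or> a = c"
    if c1: "covered_by L a b" and c2: "covered_by L c b" and z1: "z \<in> closed_segment (?p a) (?p b)"
      and z2: "z \<in> closed_segment (?p c) (?p b)" for a b c z
  proof -
    obtain u where u: "0 \<le> u" "u \<le> 1"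
      "(snd z + fst z) / 2 = X b + u * (X a - X b)" "(snd z - fst z) / 2 = Y b + u * (Y a - Y b)"
      using closed_segment_rotated z1[unfolded closed_segment_commute[of "?p a"]] .
    obtain v where v: "0 \<le> v" "v \<le> 1"
      "(snd z + fst z) / 2 = X b + v * (X c - X b)" "(snd z - fst z) / 2 = Y b + v * (Y c - Y b)"
      using closed_segment_rotated z2[unfolded closed_segment_commute[of "?p c"]] .
    have key: "t \<le> s" if "u * s = v * t" "v \<le> u" "0 < v" "t \<le> 0" for s t u v :: real
      using key0[of u "- s" v "- t"] that by simp
    have eqs: "u * (X a - X b) = v * (X c - X b)" "u * (Y a - Y b) = v * (Y c - Y b)"
      using u v by linarith+
    consider "u = 0" | "v = 0" | "0 < u" "0 < v" "u \<le> v" | "0 < u" "0 < v" "v \<le> u"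
      using u v by linarith
    then show ?thesis
    proof cases
      case 1
      have "fst z = X b - Y b" "snd z = X b + Y b" using u 1 by (auto simp: field_simps)
      then show ?thesis by (simp add: prod_eq_iff)
    next
      case 2
      have "fst z = X b - Y b" "snd z = X b + Y b" using v 2 by (auto simp: field_simps)
      then show ?thesis by (simp add: prod_eq_iff)
    next
      case 3
      have "X a - X b \<le> X c - X b" "Y a - Y b \<le> Y c - Y b"
        using key[OF eqs(1)[symmetric]] key[OF eqs(2)[symmetric]] 3 cov[OF c1] by simp_all
      then have "a \<sqsubseteq> c" "c \<sqsubseteq> b" using le cov[OF c1] cov[OF c2] by auto
      then show ?thesis using between[OF c1] cov[OF c2] by blast
    next
      case 4
      have "X c - X b \<le> X a - X b" "Y c - Y b \<le> Y a - Y b"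
        using key[OF eqs(1)] key[OF eqs(2)] 4 cov[OF c2] by simp_all
      then have "c \<sqsubseteq> a" "a \<sqsubseteq> b" using le cov[OF c1] cov[OF c2] by auto
      then show ?thesis using between[OF c2] cov[OF c1] by blast
    qed
  qed
  have point: "z = ?p e" if "X e \<le> (snd z + fst z) / 2" "(snd z + fst z) / 2 \<le> X e"
    "Y e \<le> (snd z - fst z) / 2" "(snd z - fst z) / 2 \<le> Y e" for e z
  proof -
    have "snd z + fst z = 2 * X e" "snd z - fst z = 2 * Y e" using that by auto
    then have "fst z = X e - Y e" "snd z = X e + Y e" by auto
    then show ?thesis by (simp add: prod_eq_iff)
  qed
  have meet_in: "z \<in> ?p ` ({a, b} \<inter> {c, d})"
    if c1: "covered_by L a b" and c2: "covered_by L c d" and ne: "(a, b) \<noteq> (c, d)"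
      and z1: "z \<in> closed_segment (?p a) (?p b)" and z2: "z \<in> closed_segment (?p c) (?p d)"
    for a b c d z
  proof -
    note cs = cov[OF c1] cov[OF c2]
    note bs = box[OF c1 z1] box[OF c2 z2]
    have leq: "a \<sqsubseteq> b" "c \<sqsubseteq> d" "a \<sqsubseteq> d" "c \<sqsubseteq> b"
      using cs bs by (auto simp: le)
    define u where "u = a \<squnion> c"
    have u: "u \<in> carrier L" "a \<sqsubseteq> u" "c \<sqsubseteq> u" "u \<sqsubseteq> b" "u \<sqsubseteq> d"
      using cs leq by (auto simp: u_def join_left join_right join_le)
    have "u = a \<or> u = b" "u = c \<or> u = d"
      using between[OF c1] between[OF c2] u by blast+
    \<comment> \<open>In the mixed cases \<open>a = d\<close> and \<open>b = c\<close> the bounds of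
      \<open>box\<close> leave a single point for \<open>z\<close>.\<close>
    then consider "a = c" | "a = d" | "b = c" | "b = d" by auto
    then show ?thesis
    proof cases
      case 1
      then show ?thesis using lower[OF c1, of d z] c2 z1 z2 ne by auto
    next
      case 2
      have "z = ?p a" using bs 2 by (intro point) auto
      then show ?thesis using 2 by blast
    next
      case 3
      have "z = ?p b" using bs 3 by (intro point) auto
      then show ?thesis using 3 by blast
    next
      case 4
      then show ?thesis using upper[OF c1, of c z] c2 z1 z2 ne by auto
    qed
  qed
  show ?thesis
    unfolding planar_diagram_def
  proof (intro conjI allI impI ballI subsetI, goal_cases)
    case 1
    show ?case
    proof (rule inj_onI)
      fix a b assume ab: "a \<in> carrier L" "b \<in> carrier L" "?p a = ?p b"
      then have "X a = X b" "Y a = Y b" by auto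
      with ab show "a = b" by (intro inj)
    qed
  next
    case (2 a b)
    from cov[OF 2] have "X a < X b \<or> Y a < Y b" using inj[of a b] by linarith
    then show ?case using cov[OF 2] by auto
  next
    case (3 a b c)
    then have c: "covered_by L a b" "?p c \<in> closed_segment (?p a) (?p b)" by auto
    have "a \<sqsubseteq> c" "c \<sqsubseteq> b" using box[OF c] cov[OF c(1)] 3(1) by (simp_all add: le)
    then show ?case using between[OF c(1) 3(1)] by blast
  next
    case (4 a b c d z)
    then show ?case using meet_in by blast
  qed
qed

section \<open>The lattice\<close>

datatype elem = Pt int int | Eye int int

instance elem :: countable
  by countable_datatype

fun lo1 :: "elem \<Rightarrow> int" where "lo1 (Pt i j) = i" | "lo1 (Eye i j) = i"
fun lo2 :: "elem \<Rightarrow> int" where "lo2 (Pt i j) = j" | "lo2 (Eye i j) = j"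
fun hi1 :: "elem \<Rightarrow> int" where "hi1 (Pt i j) = i" | "hi1 (Eye i j) = i + 1"
fun hi2 :: "elem \<Rightarrow> int" where "hi2 (Pt i j) = j" | "hi2 (Eye i j) = j + 1"
text \<open>The reflection of the whole construction; it halves the covering arguments and later
  carries results from the first axis to the second.\<close>

fun flip :: "elem \<Rightarrow> elem" where "flip (Pt i j) = Pt j i" | "flip (Eye i j) = Eye j i"

lemma lo_le_hi [simp]: "lo1 x \<le> hi1 x" "lo2 x \<le> hi2 x"
  by (cases x; simp)+

lemma flip_flip [simp]: "flip (flip x) = x"
  by (cases x) auto

lemma flip_sel [simp]:
  "lo1 (flip x) = lo2 x" "lo2 (flip x) = lo1 x" "hi1 (flip x) = hi2 x" "hi2 (flip x) = hi1 x"
  by (cases x; simp)+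

lemma flip_eq_iff [simp]: "flip x = flip y \<longleftrightarrow> x = y"
  by (metis flip_flip)

text \<open>The only neighbours of an eye are the lower and upper corner of its cell, so a
  comparison of different elements passes from the upper corner of one to the lower corner of the
  other.\<close>

definition below :: "elem \<Rightarrow> elem \<Rightarrow> bool" (infix "\<preceq>" 50) where
  "x \<preceq> y \<longleftrightarrow> x = y \<or> hi1 x \<le> lo1 y \<and> hi2 x \<le> lo2 y"

lemma below_refl [simp]: "x \<preceq> x"
  by (simp add: below_def)

lemma below_antisym: "x \<preceq> y \<Longrightarrow> y \<preceq> x \<Longrightarrow> x = y"
  by (cases x; cases y) (auto simp: below_def)

lemma below_trans: "x \<preceq> y \<Longrightarrow> y \<preceq> z \<Longrightarrow> x \<preceq> z"
  by (cases x; cases y; cases z) (auto simp: below_def)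

lemma below_simps [simp]:
  "Pt i j \<preceq> Pt a b \<longleftrightarrow> i \<le> a \<and> j \<le> b"
  "Pt i j \<preceq> Eye a b \<longleftrightarrow> i \<le> a \<and> j \<le> b"
  "Eye i j \<preceq> Pt a b \<longleftrightarrow> i < a \<and> j < b"
  "Eye i j \<preceq> Eye a b \<longleftrightarrow> i = a \<and> j = b \<or> i < a \<and> j < b"
  by (auto simp: below_def)

lemma below_flip [simp]: "flip x \<preceq> flip y \<longleftrightarrow> x \<preceq> y"
  by (auto simp: below_def)

text \<open>Positivity keeps deleted points away from the cells that carry eyes. Oddness excludes
  consecutive forks, so one step off a deleted point suffices, and it pairs the edges
  \<open>2 * k\<close> and \<open>2 * k + 1\<close> around the fork
  \<open>2 * k + 1\<close>.\<close>

definition fork :: "int \<Rightarrow> bool" where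
  "fork i \<longleftrightarrow> 0 < i \<and> odd i"

text \<open>The least grid point above \<open>(i, j)\<close> is \<open>(cl i j, cl j i)\<close>.\<close>

definition cl :: "int \<Rightarrow> int \<Rightarrow> int" where
  "cl i j = (if fork i \<and> i < j then i + 1 else i)"

definition jn :: "elem \<Rightarrow> elem \<Rightarrow> elem" where
  "jn x y = (if x \<preceq> y then y else if y \<preceq> x then x else
     let i = max (hi1 x) (hi1 y); j = max (hi2 x) (hi2 y) in Pt (cl i j) (cl j i))"

definition mt :: "elem \<Rightarrow> elem \<Rightarrow> elem" where
  "mt x y = (if x \<preceq> y then x else if y \<preceq> x then y else
     Pt (min (lo1 x) (lo1 y)) (min (lo2 x) (lo2 y)))"

lemma jn_commute: "jn x y = jn y x"
  using below_antisym by (auto simp: jn_def max.commute Let_def)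

lemma mt_commute: "mt x y = mt y x"
  using below_antisym by (auto simp: mt_def min.commute)

lemma jn_flip: "jn (flip x) (flip y) = flip (jn x y)"
  by (simp add: jn_def Let_def)

lemma mt_flip: "mt (flip x) (flip y) = flip (mt x y)"
  by (simp add: mt_def)

lemma not_fork_Suc: "fork i \<Longrightarrow> \<not> fork (i + 1)"
  by (simp add: fork_def)

lemma cl_ge: "i \<le> cl i j"
  by (simp add: cl_def)

text \<open>\<open>col i\<close> is the colour of the edge \<open>[i, i + 1]\<close> on each axis; \<open>{l..t}\<close> is the range of both coordinates.\<close>

locale fork_grid =
  fixes l t :: int and col :: "int \<Rightarrow> 'c"
  assumes l_neg: "l < 0" and t_nonneg: "0 \<le> t" and t_even: "even t"
    and col_nonneg: "col ` {0..<t} \<subseteq> col ` {l..<0}"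
begin

section \<open>Elements of the lattice and closure under joins and meets\<close>

definition grid :: "int \<Rightarrow> int \<Rightarrow> bool" where
  "grid i j \<longleftrightarrow> l \<le> i \<and> i \<le> t \<and> l \<le> j \<and> j \<le> t \<and> (fork i \<longrightarrow> j \<le> i) \<and> (fork j \<longrightarrow> i \<le> j)"

text \<open>A negative coordinate guarantees that no corner of the cell was deleted, since deleted
  points have both coordinates positive.\<close>

definition cell :: "int \<Rightarrow> int \<Rightarrow> bool" where
  "cell i j \<longleftrightarrow> l \<le> i \<and> i < t \<and> l \<le> j \<and> j < t \<and> (i < 0 \<or> j < 0) \<and> col i = col j"

fun mem :: "elem \<Rightarrow> bool" where
  "mem (Pt i j) = grid i j"
| "mem (Eye i j) = cell i j"

lemma grid_flip: "grid i j \<longleftrightarrow> grid j i"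
  by (auto simp: grid_def)

lemma cell_flip: "cell i j \<longleftrightarrow> cell j i"
  by (auto simp: cell_def)

lemma mem_flip [simp]: "mem (flip x) \<longleftrightarrow> mem x"
  by (cases x) (auto simp: grid_flip cell_flip)

lemma cell_corners:
  assumes "cell i j"
  shows "grid i j" "grid (i + 1) j" "grid i (j + 1)" "grid (i + 1) (j + 1)"
  using assms by (auto simp: cell_def grid_def fork_def)

lemma fork_less: "fork i \<Longrightarrow> i \<le> t \<Longrightarrow> i < t"
  using t_even by (cases "i = t") (auto simp: fork_def)

lemma not_fork_l [simp]: "\<not> fork l" and not_fork_t [simp]: "\<not> fork t"
  using l_neg t_even by (auto simp: fork_def)

lemma grid_axes:
  assumes "l \<le> i" "i \<le> t"
  shows "grid i l" "grid l i"
  using assms l_neg t_nonneg by (auto simp: grid_def fork_def)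

text \<open>At most one coordinate moves, the smaller one, and the index after a fork is not a fork.
  The result stays in range because \<open>t\<close> is even and hence not a fork.\<close>

lemma grid_cl:
  assumes "l \<le> i" "i \<le> t" "l \<le> j" "j \<le> t"
  shows "grid (cl i j) (cl j i)"
  using assms fork_less[of i] fork_less[of j] not_fork_Suc[of i] not_fork_Suc[of j]
  by (auto simp: grid_def cl_def)

lemma cl_grid: "grid i j \<Longrightarrow> cl i j = i" "grid i j \<Longrightarrow> cl j i = j"
  by (auto simp: grid_def cl_def)

text \<open>If \<open>cl\<close> moves \<open>i\<close>, no grid point above \<open>(i, j)\<close>
  has first coordinate \<open>i\<close>: column \<open>i\<close> ends at row \<open>i\<close>, which
  is below row \<open>j\<close>.\<close>

lemma cl_least:
  assumes "grid a b" "i \<le> a" "j \<le> b"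
  shows "cl i j \<le> a" "cl j i \<le> b"
proof -
  have "i \<noteq> a" if "fork i" "i < j" using assms that by (auto simp: grid_def)
  then show "cl i j \<le> a" using assms by (auto simp: cl_def)
  have "j \<noteq> b" if "fork j" "j < i" using assms that by (auto simp: grid_def)
  then show "cl j i \<le> b" using assms by (auto simp: cl_def)
qed

lemma mem_bounds:
  assumes "mem x"
  shows "grid (lo1 x) (lo2 x)" "grid (hi1 x) (hi2 x)"
    "l \<le> lo1 x" "l \<le> lo2 x" "hi1 x \<le> t" "hi2 x \<le> t"
proof -
  show "grid (lo1 x) (lo2 x)" "grid (hi1 x) (hi2 x)"
    using assms cell_corners[of "lo1 x" "lo2 x"] by (cases x; simp)+
  then show "l \<le> lo1 x" "l \<le> lo2 x" "hi1 x \<le> t" "hi2 x \<le> t"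
    by (auto simp: grid_def)
qed

lemma mem_jn:
  assumes "mem x" "mem y"
  shows "mem (jn x y)"
proof -
  have "l \<le> hi1 x" "l \<le> hi2 x" using mem_bounds[OF assms(1)] by (auto intro: order_trans)
  then show ?thesis
    using assms mem_bounds[OF assms(1)] mem_bounds[OF assms(2)]
    by (auto simp: jn_def Let_def intro!: grid_cl)
qed

lemma mem_mt:
  assumes "mem x" "mem y"
  shows "mem (mt x y)"
  using assms mem_bounds(1)[OF assms(1)] mem_bounds(1)[OF assms(2)]
  by (auto simp: mt_def grid_def min_def)

lemma jn_upper: "x \<preceq> jn x y" "y \<preceq> jn x y"
proof -
  have *: "x \<preceq> jn x y" for x y
  proof -
    have "hi1 x \<le> cl (max (hi1 x) (hi1 y)) k" "hi2 x \<le> cl (max (hi2 x) (hi2 y)) k" for k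
      by (meson cl_ge max.bounded_iff)+
    then show ?thesis by (auto simp: jn_def Let_def below_def)
  qed
  show "x \<preceq> jn x y" "y \<preceq> jn x y"
    using *[of x y] *[of y x] by (auto simp: jn_commute)
qed

lemma jn_least:
  assumes "mem z" "x \<preceq> z" "y \<preceq> z"
  shows "jn x y \<preceq> z"
proof (cases "x \<preceq> y \<or> y \<preceq> x")
  case True
  then show ?thesis using assms by (auto simp: jn_def)
next
  case False
  then have "x \<noteq> z" "y \<noteq> z" using assms by auto
  then have h: "hi1 x \<le> lo1 z" "hi2 x \<le> lo2 z" "hi1 y \<le> lo1 z" "hi2 y \<le> lo2 z"
    using assms by (auto simp: below_def)
  have "max (hi1 x) (hi1 y) \<le> lo1 z" "max (hi2 x) (hi2 y) \<le> lo2 z" using h by auto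
  then show ?thesis
    using False cl_least[OF mem_bounds(1)[OF assms(1)]] by (auto simp: jn_def Let_def below_def)
qed

lemma mt_lower: "mt x y \<preceq> x" "mt x y \<preceq> y"
  by (auto simp: mt_def below_def)

lemma mt_greatest:
  assumes "z \<preceq> x" "z \<preceq> y"
  shows "z \<preceq> mt x y"
  using assms by (auto simp: mt_def below_def)

lemma jn_Pt_Pt: "grid a b \<Longrightarrow> grid i j \<Longrightarrow> jn (Pt a b) (Pt i j) = Pt (cl (max a i) (max b j)) (cl (max b j) (max a i))"
  by (auto simp: jn_def Let_def cl_grid max_def)

lemma jn_Pt_Eye: "grid a b \<Longrightarrow> jn (Pt a b) (Eye i j) =
   (if a \<le> i \<and> b \<le> j then Eye i j
    else Pt (cl (max a (i + 1)) (max b (j + 1))) (cl (max b (j + 1)) (max a (i + 1))))"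
proof (cases "i < a \<and> j < b")
  case True
  then have "max a (i + 1) = a" "max b (j + 1) = b" by auto
  moreover assume "grid a b"
  ultimately show ?thesis using True by (auto simp: jn_def Let_def cl_grid)
qed (auto simp: jn_def Let_def)

lemma mt_Pt_Pt: "mt (Pt a b) (Pt i j) = Pt (min a i) (min b j)"
  by (auto simp: mt_def min_def)

lemma mt_Pt_Eye: "mt (Pt a b) (Eye i j) =
   (if i < a \<and> j < b then Eye i j else Pt (min a i) (min b j))"
  by (auto simp: mt_def min_def)

lemma finite_mem: "finite {x. mem x}"
proof (rule finite_subset)
  show "{x. mem x} \<subseteq> case_prod Pt ` ({l..t} \<times> {l..t}) \<union> case_prod Eye ` ({l..t} \<times> {l..t})"
  proof
    fix x assume "x \<in> {x. mem x}"
    then show "x \<in> case_prod Pt ` ({l..t} \<times> {l..t}) \<union> case_prod Eye ` ({l..t} \<times> {l..t})"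
      by (cases x) (auto simp: grid_def cell_def image_iff)
  qed
qed auto

subsection \<open>Semimodularity\<close>

definition covers :: "elem \<Rightarrow> elem \<Rightarrow> bool" where
  "covers x y \<longleftrightarrow> mem x \<and> mem y \<and> x \<preceq> y \<and> x \<noteq> y \<and> (\<forall>z. mem z \<and> x \<preceq> z \<and> z \<preceq> y \<longrightarrow> z = x \<or> z = y)"

lemma coversD:
  assumes "covers x y"
  shows "mem x" "mem y" "x \<preceq> y" "x \<noteq> y" "\<And>z. \<lbrakk>mem z; x \<preceq> z; z \<preceq> y\<rbrakk> \<Longrightarrow> z = x \<or> z = y"
  using assms unfolding covers_def by blast+

lemma covers_flip [simp]: "covers (flip x) (flip y) \<longleftrightarrow> covers x y"
proof -
  have "covers (flip x) (flip y)" if "covers x y" for x y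
    unfolding covers_def
  proof (intro conjI allI impI)
    fix z assume "mem z \<and> flip x \<preceq> z \<and> z \<preceq> flip y"
    then have "mem (flip z) \<and> x \<preceq> flip z \<and> flip z \<preceq> y"
      by (metis below_flip flip_flip mem_flip)
    then have "flip z = x \<or> flip z = y" using that by (auto simp: covers_def)
    then show "z = flip x \<or> z = flip y" by auto
  qed (use that in \<open>auto simp: covers_def\<close>)
  from this[of x y] this[of "flip x" "flip y"] show ?thesis by auto
qed

text \<open>If \<open>(i + 1, j)\<close> was deleted, the step to the right is longer and ends at
  the rounding of that point.\<close>

lemma covers_right:
  assumes g: "grid i j" and "i < t"
  shows "covers (Pt i j) (Pt (cl (i + 1) j) (cl j (i + 1)))" (is "covers ?x ?u")
proof -
  have u: "grid (cl (i + 1) j) (cl j (i + 1))"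
    using assms by (intro grid_cl) (auto simp: grid_def)
  have ge: "i + 1 \<le> cl (i + 1) j" "j \<le> cl j (i + 1)" by (rule cl_ge)+
  have xu: "?x \<preceq> ?u" "?x \<noteq> ?u" using ge by (simp, intro notI, simp)
  have P: "z = ?u" if z: "z = Pt p q" "grid p q" "?x \<preceq> z" "z \<preceq> ?u" "z \<noteq> ?x" for z p q
  proof (cases "i + 1 \<le> p")
    case True
    have "?u \<preceq> z" using cl_least[OF z(2) True, of j] z by auto
    with z(4) show ?thesis by (rule below_antisym)
  next
    case False
    then have "p = i" "j + 1 \<le> q" using z by auto
    \<comment> \<open>\<open>?u\<close> exceeds \<open>j\<close> in the second coordinate, so
      \<open>j\<close> was rounded up. With \<open>grid i j\<close> this forces
      \<open>i = j\<close>, and column \<open>j\<close> has no point above row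
      \<open>j\<close>.\<close>
    then have "fork j" "j < i + 1" using z by (auto simp: cl_def split: if_splits)
    then show ?thesis using g z(2) \<open>p = i\<close> \<open>j + 1 \<le> q\<close> by (auto simp: grid_def)
  qed
  have E: False if z: "cell p q" "?x \<preceq> Eye p q" "Eye p q \<preceq> ?u" for p q
  proof -
    \<comment> \<open>With an eye in the interval, both side corners of its cell would be there too,
      and both would equal \<open>?u\<close>.\<close>
    have "Pt (p + 1) q = ?u" by (rule P[OF refl cell_corners(2)[OF z(1)]]) (use z in auto)
    moreover have "Pt p (q + 1) = ?u" by (rule P[OF refl cell_corners(3)[OF z(1)]]) (use z in auto)
    ultimately show False by auto
  qed
  show ?thesis
    unfolding covers_def
  proof (intro conjI allI impI)
    fix z assume z: "mem z \<and> ?x \<preceq> z \<and> z \<preceq> ?u"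
    show "z = ?x \<or> z = ?u"
    proof (cases z)
      case (Pt p q)
      then show ?thesis using P[of z p q] z by auto
    next
      case (Eye p q)
      then show ?thesis using E[of p q] z by auto
    qed
  qed (use g u xu in simp_all)
qed

lemma covers_left:
  assumes "grid i j" and "j < t"
  shows "covers (Pt i j) (Pt (cl i (j + 1)) (cl (j + 1) i))"
proof -
  have "covers (Pt j i) (Pt (cl (j + 1) i) (cl i (j + 1)))"
    using assms by (intro covers_right) (simp add: grid_flip[of j])
  then show ?thesis by (subst covers_flip[symmetric]) simp
qed

lemma covers_Eye:
  assumes "cell i j"
  shows "covers (Pt i j) (Eye i j)" "covers (Eye i j) (Pt (i + 1) (j + 1))"
proof -
  have "z = Pt i j \<or> z = Eye i j" if "mem z" "Pt i j \<preceq> z" "z \<preceq> Eye i j" for z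
    using that by (cases z) auto
  then show "covers (Pt i j) (Eye i j)"
    using assms cell_corners[OF assms] by (auto simp: covers_def)
  have "z = Eye i j \<or> z = Pt (i + 1) (j + 1)" if "mem z" "Eye i j \<preceq> z" "z \<preceq> Pt (i + 1) (j + 1)" for z
    using that by (cases z) auto
  then show "covers (Eye i j) (Pt (i + 1) (j + 1))"
    using assms cell_corners[OF assms] by (auto simp: covers_def)
qed

text \<open>A grid point advancing in the first coordinate lies above the rounding of
  \<open>(i + 1, j)\<close>, itself a cover; an eye lies above the lower corner of its cell, which
  must then be the given point.\<close>

lemma covers_PtD:
  assumes cov: "covers (Pt i j) a" and a: "i < hi1 a"
  shows "a = Eye i j \<and> cell i j \<or> a = Pt (cl (i + 1) j) (cl j (i + 1)) \<and> i < t"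
proof (cases a)
  case (Pt p q)
  then have "mem a" and g: "grid i j" using cov by (auto simp: covers_def)
  then have it: "i < t" using a mem_bounds(5)[of a] by simp
  have c: "covers (Pt i j) (Pt (cl (i + 1) j) (cl j (i + 1)))" by (rule covers_right[OF g it])
  have "Pt (cl (i + 1) j) (cl j (i + 1)) \<preceq> a"
    using a Pt cov cl_least[of p q "i + 1" j] by (auto simp: covers_def)
  then have "Pt (cl (i + 1) j) (cl j (i + 1)) = a"
    using coversD(5)[OF cov coversD(2,3)[OF c]] coversD(4)[OF c] by metis
  then show ?thesis using it by simp
next
  case (Eye p q)
  then have q: "cell p q" "Pt i j \<preceq> Pt p q" using cov by (auto simp: covers_def)
  have "mem (Pt p q)" "Pt p q \<preceq> Eye p q" "Pt p q \<noteq> Eye p q" using cell_corners[OF q(1)] by auto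
  then have "Pt p q = Pt i j"
    using coversD(5)[OF cov, of "Pt p q"] q(2) Eye by simp
  then show ?thesis using q(1) Eye by simp
qed

text \<open>One half of semimodularity: \<open>b\<close> has the first coordinate of the meet and
  \<open>a\<close> advances in it, so one step to the right from \<open>b\<close> (or the upper
  corner of its cell, if \<open>b\<close> is an eye) gives a cover of \<open>b\<close> that passes
  \<open>a\<close>. The other half is the reflection.\<close>

lemma upper_semimodular_aux:
  assumes b: "mem b" "Pt i j \<preceq> b" "lo1 b = i"
    and cov: "covers (Pt i j) a" and inc: "\<not> b \<preceq> a" and a: "i < hi1 a"
  shows "\<exists>u. covers b u \<and> a \<preceq> u"
proof (cases b)
  case (Pt p q)
  have q1: "p = i" using b(3) unfolding Pt by simp
  have q2: "grid i q" using b(1) unfolding Pt q1 by simp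
  have q3: "j \<le> q" using b(2) unfolding Pt by simp
  have "j \<noteq> q"
  proof
    assume "j = q"
    then have "b = Pt i j" using Pt q1 by simp
    then show False using inc coversD(3)[OF cov] by simp
  qed
  then have "j < q" using q3 by simp
  have "i < t" using covers_PtD[OF cov a] unfolding cell_def by blast
  then have c: "covers b (Pt (cl (i + 1) q) (cl q (i + 1)))" using covers_right[OF q2] Pt q1 by simp
  then have gu: "grid (cl (i + 1) q) (cl q (i + 1))" unfolding covers_def by simp
  have ge: "i + 1 \<le> cl (i + 1) q" "q \<le> cl q (i + 1)" by (rule cl_ge)+
  have "a \<preceq> Pt (cl (i + 1) q) (cl q (i + 1))"
    using covers_PtD[OF cov a]
  proof (elim disjE conjE)
    assume "a = Eye i j"
    then show ?thesis using ge \<open>j < q\<close> by simp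
  next
    assume "a = Pt (cl (i + 1) j) (cl j (i + 1))"
    then show ?thesis using cl_least[OF gu, of "i + 1" j] ge \<open>j < q\<close> by simp
  qed
  then show ?thesis using c by blast
next
  case (Eye p q)
  have q: "p = i" "cell i q" "j \<le> q" using b by (simp_all add: Eye)
  have c: "covers b (Pt (i + 1) (q + 1))" using covers_Eye[OF q(2)] Eye q by simp
  have "a \<preceq> Pt (i + 1) (q + 1)"
    using covers_PtD[OF cov a] q(3) cl_least[OF cell_corners(4)[OF q(2)], of "i + 1" j] by auto
  then show ?thesis using c by blast
qed

lemma upper_semimodular:
  assumes mem: "mem a" "mem b" and cov: "covers (mt a b) a"
  shows "covers b (jn a b)"
proof (cases "b \<preceq> a")
  case True
  then have "mt a b = b" "jn a b = a"
    using below_antisym[of a b] by (auto simp: mt_def jn_def)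
  then show ?thesis using cov by simp
next
  case False
  have inc: "\<not> a \<preceq> b" using cov by (auto simp: mt_def covers_def)
  define i j where "i = min (lo1 a) (lo1 b)" and "j = min (lo2 a) (lo2 b)"
  have m: "mt a b = Pt i j" using False inc by (simp add: mt_def i_def j_def)
  then have c: "covers (Pt i j) a" and b: "Pt i j \<preceq> b"
    using cov mt_lower(2)[of a b] by simp_all
  have ia: "i \<le> lo1 a" "j \<le> lo2 a" and ne: "Pt i j \<noteq> a" using c by (auto simp: i_def j_def covers_def)
  \<comment> \<open>Any cover of \<open>b\<close> above \<open>a\<close> suffices: the join lies
    between \<open>b\<close> and this cover and differs from \<open>b\<close>.\<close>
  have "\<exists>u. covers b u \<and> a \<preceq> u"
  proof (cases "lo1 b = i \<and> i < hi1 a")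
    case True
    then show ?thesis using upper_semimodular_aux[OF mem(2) b _ c False] by blast
  next
    case F: False
    \<comment> \<open>If neither half applied, \<open>b\<close> would exceed the meet in a direction
      in which \<open>a\<close> advances, far enough to put \<open>a\<close> below
      \<open>b\<close>.\<close>
    have "lo2 b = j \<and> j < hi2 a"
    proof (rule ccontr)
      assume n: "\<not> (lo2 b = j \<and> j < hi2 a)"
      have le: "i \<le> lo1 b" "j \<le> lo2 b" by (auto simp: i_def j_def)
      show False
      proof (cases a)
        case (Pt p q)
        then consider "i < p" | "j < q" "i = p" using ia ne by fastforce
        then show False
        proof cases
          case 1
          then have "i < hi1 a" using Pt by simp
          then have a: "a = Pt (cl (i + 1) j) (cl j (i + 1))" using covers_PtD[OF c] Pt by auto
          have "i < lo1 b" using F \<open>i < hi1 a\<close> le by auto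
          then have "cl (i + 1) j \<le> lo1 b" "cl j (i + 1) \<le> lo2 b"
            using cl_least[OF mem_bounds(1)[OF mem(2)], of "i + 1" j] le by auto
          then show False using inc by (simp add: a below_def)
        next
          case 2
          then have h: "j < hi1 (flip a)" and "lo2 b > j" using Pt n le by auto
          have "covers (Pt j i) (flip a)" using c covers_flip[of "Pt i j" a] by simp
          then have "flip a = Pt (cl (j + 1) i) (cl i (j + 1))" using covers_PtD[OF _ h] Pt by auto
          then have a: "a = Pt (cl i (j + 1)) (cl (j + 1) i)" using Pt by simp
          have "cl i (j + 1) \<le> lo1 b" "cl (j + 1) i \<le> lo2 b"
            using cl_least[OF mem_bounds(1)[OF mem(2)], of i "j + 1"] le \<open>lo2 b > j\<close> by auto
          then show False using inc by (simp add: a below_def)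
        qed
      next
        case (Eye p q)
        then have "i < hi1 a" "j < hi2 a" using ia by auto
        then have a: "a = Eye i j" using covers_PtD[OF c] Eye by auto
        show False using F n inc le by (auto simp: a below_def)
      qed
    qed
    then have "\<exists>u. covers (flip b) u \<and> flip a \<preceq> u"
      using upper_semimodular_aux[of "flip b" j i "flip a"] mem b c False
        covers_flip[of "Pt i j" a] below_flip[of "Pt i j" b]
      by simp
    then show ?thesis by (metis below_flip covers_flip flip_flip)
  qed
  then obtain u where u: "covers b u" "a \<preceq> u" by blast
  have "mem u" "b \<preceq> u" using u(1) by (auto simp: covers_def)
  then have "jn a b \<preceq> u" using u(2) by (intro jn_least)
  moreover have "b \<noteq> jn a b" using jn_upper(1)[of a b] inc by auto
  ultimately have "jn a b = u"
    using coversD(5)[OF u(1) mem_jn[OF mem]] jn_upper(2)[of b a] by simp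
  with u show ?thesis by simp
qed

end

section \<open>Congruences\<close>

definition linked :: "(int \<Rightarrow> 'c) \<Rightarrow> 'c set \<Rightarrow> int \<Rightarrow> int \<Rightarrow> bool" where
  "linked col I i k \<longleftrightarrow> (\<forall>m. min i k \<le> m \<and> m < max i k \<longrightarrow> col m \<in> I)"

lemma linked_refl [simp]: "linked col I i i"
  by (auto simp: linked_def)

lemma linked_sym: "linked col I i k \<Longrightarrow> linked col I k i"
  by (simp add: linked_def min.commute max.commute)

lemma linked_trans:
  assumes "linked col I i j" "linked col I j k"
  shows "linked col I i k"
  unfolding linked_def
proof (intro allI impI)
  fix m assume "min i k \<le> m \<and> m < max i k"
  then have "min i j \<le> m \<and> m < max i j \<or> min j k \<le> m \<and> m < max j k" by linarith
  then show "col m \<in> I" using assms by (auto simp: linked_def)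
qed

lemma linked_Suc [simp]: "linked col I i (i + 1) \<longleftrightarrow> col i \<in> I"
proof -
  have "min i (i + 1) \<le> m \<and> m < max i (i + 1) \<longleftrightarrow> m = i" for m :: int by auto
  then show ?thesis by (simp add: linked_def)
qed

lemma linked_mono: "linked col I i k \<Longrightarrow> I \<subseteq> I' \<Longrightarrow> linked col I' i k"
  by (auto simp: linked_def)

lemma linked_max:
  assumes "linked col I i k"
  shows "linked col I (max i m) (max k m)"
  unfolding linked_def
proof (intro allI impI)
  fix n assume "min (max i m) (max k m) \<le> n \<and> n < max (max i m) (max k m)"
  then have "min i k \<le> n \<and> n < max i k" by linarith
  then show "col n \<in> I" using assms by (auto simp: linked_def)
qed

lemma linked_min:
  assumes "linked col I i k"
  shows "linked col I (min i m) (min k m)"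
  unfolding linked_def
proof (intro allI impI)
  fix n assume "min (min i m) (min k m) \<le> n \<and> n < max (min i m) (min k m)"
  then have "min i k \<le> n \<and> n < max i k" by linarith
  then show "col n \<in> I" using assms by (auto simp: linked_def)
qed

context fork_grid
begin

section \<open>From closed sets of colours to congruences\<close>

definition closed_colors :: "'c set \<Rightarrow> bool" where
  "closed_colors I \<longleftrightarrow> (\<forall>k. fork k \<and> k < t \<and> col (k - 1) \<in> I \<longrightarrow> col k \<in> I)"

definition collapsed :: "'c set \<Rightarrow> elem \<Rightarrow> bool" where
  "collapsed I x \<longleftrightarrow> linked col I (lo1 x) (hi1 x) \<and> linked col I (lo2 x) (hi2 x)"

text \<open>\<open>collapsed\<close> is vacuous for grid points. An eye is a class of its own unless
  both edges of its cell are collapsed; then it belongs to the class of its corners.\<close>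

definition Th :: "'c set \<Rightarrow> elem \<Rightarrow> elem \<Rightarrow> bool" where
  "Th I x y \<longleftrightarrow> x = y \<or> collapsed I x \<and> collapsed I y \<and>
     linked col I (lo1 x) (lo1 y) \<and> linked col I (lo2 x) (lo2 y)"

lemma Th_refl [simp]: "Th I x x"
  by (simp add: Th_def)

lemma Th_sym: "Th I x y \<Longrightarrow> Th I y x"
  by (auto simp: Th_def intro: linked_sym)

lemma Th_trans: "Th I x y \<Longrightarrow> Th I y z \<Longrightarrow> Th I x z"
  by (auto simp: Th_def intro: linked_trans)

lemma Th_mono: "Th I x y \<Longrightarrow> I \<subseteq> I' \<Longrightarrow> Th I' x y"
  by (auto simp: Th_def collapsed_def intro: linked_mono)

lemma Th_Pt: "Th I (Pt a b) (Pt i j) \<longleftrightarrow> linked col I a i \<and> linked col I b j"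
  by (auto simp: Th_def collapsed_def)

text \<open>The edge skipped when \<open>i\<close> is rounded up is collapsed already. If
  \<open>i\<close> is less than \<open>i'\<close>, it lies between them; if greater, the edge
  \<open>i - 1\<close> does, and closure at the fork yields \<open>col i\<close>; if they are equal,
  it lies between \<open>j'\<close> and \<open>j\<close>.\<close>

lemma linked_cl_aux:
  assumes I: "closed_colors I" and i: "linked col I i i'" and j: "linked col I j j'"
    and le: "i \<le> t" and f: "fork i" "i < j" and n: "i = i' \<Longrightarrow> j' \<le> i"
  shows "col i \<in> I"
proof -
  consider "i < i'" | "i' < i" | "i = i'" by linarith
  then show ?thesis
  proof cases
    case 1
    then show ?thesis using i by (auto simp: linked_def)
  next
    case 2
    then have "col (i - 1) \<in> I" using i by (auto simp: linked_def)
    then show ?thesis using I f(1) fork_less[OF f(1) le] by (auto simp: closed_colors_def)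
  next
    case 3
    then show ?thesis using n f j by (auto simp: linked_def)
  qed
qed

lemma linked_cl:
  assumes I: "closed_colors I" and i: "linked col I i i'" and j: "linked col I j j'"
    and le: "i \<le> t" "i' \<le> t"
  shows "linked col I (cl i j) (cl i' j')"
proof -
  have 1: "col i \<in> I" if "fork i" "i < j" "i = i' \<Longrightarrow> j' \<le> i"
    using linked_cl_aux[OF I i j le(1)] that by blast
  have 2: "col i' \<in> I" if "fork i'" "i' < j'" "i' = i \<Longrightarrow> j \<le> i'"
    using linked_cl_aux[OF I linked_sym[OF i] linked_sym[OF j] le(2)] that by blast
  show ?thesis
  proof (cases "i = i' \<and> i < j \<and> i' < j'")
    case True
    then show ?thesis by (simp add: cl_def)
  next
    case False
    have a: "linked col I i (cl i j)" using 1 False by (auto simp: cl_def)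
    have b: "linked col I i' (cl i' j')" using 2 False by (auto simp: cl_def)
    show ?thesis using linked_trans[OF linked_trans[OF linked_sym[OF a] i] b] .
  qed
qed

lemma Th_hi: "collapsed I x \<Longrightarrow> Th I x (Pt (hi1 x) (hi2 x))"
  and Th_lo: "collapsed I x \<Longrightarrow> Th I x (Pt (lo1 x) (lo2 x))"
  by (auto simp: Th_def collapsed_def)

lemma Th_jn_Pt:
  assumes I: "closed_colors I" and Th: "Th I (Pt a b) (Pt a' b')"
    and g: "grid a b" "grid a' b'" and z: "mem z"
  shows "Th I (jn (Pt a b) z) (jn (Pt a' b') z)"
proof -
  have L: "linked col I a a'" "linked col I b b'" using Th by (simp_all add: Th_Pt)
  have le: "a \<le> t" "b \<le> t" "a' \<le> t" "b' \<le> t" using g by (auto simp: grid_def)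
  have le': "hi1 z \<le> t" "hi2 z \<le> t" using mem_bounds[OF z] by auto
  have PP: "linked col I (cl (max a p) (max b q)) (cl (max a' p) (max b' q))"
    "linked col I (cl (max b q) (max a p)) (cl (max b' q) (max a' p))"
    if "p \<le> t" "q \<le> t" for p q
    using that le by (auto intro!: linked_cl[OF I] linked_max L)
  show ?thesis
  proof (cases z)
    case (Pt p q)
    then show ?thesis using z g PP[of p q] le' by (simp add: jn_Pt_Pt Th_Pt)
  next
    case (Eye i j)
    note PP' = PP[of "i + 1" "j + 1"]
    have col: "col i = col j" using z Eye by (simp add: cell_def)
    have up: "Th I (Eye i j) (jn (Pt a' b') z)"
      if "a \<le> i" "b \<le> j" "\<not> (a' \<le> i \<and> b' \<le> j)"
        and L: "linked col I a a'" "linked col I b b'" and g: "grid a' b'"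
        and PP: "linked col I (cl (max a (i+1)) (max b (j+1))) (cl (max a' (i+1)) (max b' (j+1)))"
        "linked col I (cl (max b (j+1)) (max a (i+1))) (cl (max b' (j+1)) (max a' (i+1)))"
      for a b a' b'
    proof -
      \<comment> \<open>One join is the eye and the other is not, so the path from \<open>a\<close>
        to \<open>a'\<close> or the one from \<open>b\<close> to \<open>b'\<close> crosses an edge
        of the cell. As its two edges have equal colours, both collapse.\<close>
      have "linked col I i (i + 1) \<or> linked col I j (j + 1)"
        using that(1-3) L by (auto simp: linked_def not_le)
      then have c: "col i \<in> I" "col j \<in> I" using col by auto
      have m: "max a (i+1) = i+1" "max b (j+1) = j+1" using that by auto
      have id: "cl (i+1) (j+1) = i+1" "cl (j+1) (i+1) = j+1"
        using cl_grid cell_corners(4)[of i j] z Eye by auto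
      have "Th I (Eye i j) (Pt (i+1) (j+1))"
        using c by (intro Th_hi[of I "Eye i j", simplified]) (simp add: collapsed_def)
      moreover have "Th I (Pt (i+1) (j+1)) (jn (Pt a' b') z)"
        using PP that(3) g unfolding m id by (auto simp: jn_Pt_Eye Eye Th_Pt)
      ultimately show ?thesis by (rule Th_trans)
    qed
    consider "a \<le> i \<and> b \<le> j" "a' \<le> i \<and> b' \<le> j" | "a \<le> i \<and> b \<le> j" "\<not> (a' \<le> i \<and> b' \<le> j)"
      | "\<not> (a \<le> i \<and> b \<le> j)" "a' \<le> i \<and> b' \<le> j" | "\<not> (a \<le> i \<and> b \<le> j)" "\<not> (a' \<le> i \<and> b' \<le> j)"
      by blast
    then show ?thesis
    proof cases
      case 1
      then show ?thesis using g by (simp add: jn_Pt_Eye Eye)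
    next
      case 2
      then have "Th I (Eye i j) (jn (Pt a' b') z)"
        using PP' le' Eye L g by (intro up[of a b]) auto
      then show ?thesis using 2 g(1) by (simp add: jn_Pt_Eye Eye)
    next
      case 3
      then have "Th I (Eye i j) (jn (Pt a b) z)"
        using PP' le' Eye L g by (intro up[of a' b']) (auto intro: linked_sym)
      then have "Th I (jn (Pt a b) z) (Eye i j)" by (rule Th_sym)
      moreover have "jn (Pt a' b') z = Eye i j" using 3 g(2) by (simp add: jn_Pt_Eye Eye)
      ultimately show ?thesis by simp
    next
      case 4
      then show ?thesis using PP' le'
        unfolding Eye jn_Pt_Eye[OF g(1)] jn_Pt_Eye[OF g(2)] by (auto simp: Th_Pt)
    qed
  qed
qed

lemma Th_mt_Pt:
  assumes Th: "Th I (Pt a b) (Pt a' b')" and z: "mem z"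
  shows "Th I (mt (Pt a b) z) (mt (Pt a' b') z)"
proof -
  have L: "linked col I a a'" "linked col I b b'" using Th by (simp_all add: Th_Pt)
  show ?thesis
  proof (cases z)
    case (Pt p q)
    then show ?thesis using L by (auto simp: mt_Pt_Pt Th_Pt intro: linked_min)
  next
    case (Eye i j)
    have col: "col i = col j" using z Eye by (simp add: cell_def)
    have up: "Th I (Eye i j) (mt (Pt a' b') z)"
      if "i < a" "j < b" "\<not> (i < a' \<and> j < b')" and L: "linked col I a a'" "linked col I b b'"
      for a b a' b'
    proof -
      have "linked col I i (i + 1) \<or> linked col I j (j + 1)"
        using that(1-3) L by (auto simp: linked_def not_less)
      then have c: "col i \<in> I" "col j \<in> I" using col by auto
      have "Th I (Eye i j) (Pt i j)"
        using c by (intro Th_lo[of I "Eye i j", simplified]) (simp add: collapsed_def)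
      moreover have "min a i = i" "min b j = j" using that by auto
      then have "Th I (Pt i j) (mt (Pt a' b') z)"
        using that(3) linked_min[OF L(1), of i] linked_min[OF L(2), of j]
        by (auto simp: mt_Pt_Eye Eye Th_Pt)
      ultimately show ?thesis by (rule Th_trans)
    qed
    consider "i < a \<and> j < b" "i < a' \<and> j < b'" | "i < a \<and> j < b" "\<not> (i < a' \<and> j < b')"
      | "\<not> (i < a \<and> j < b)" "i < a' \<and> j < b'" | "\<not> (i < a \<and> j < b)" "\<not> (i < a' \<and> j < b')"
      by blast
    then show ?thesis
    proof cases
      case 1
      then show ?thesis by (simp add: mt_Pt_Eye Eye)
    next
      case 2
      then have "Th I (Eye i j) (mt (Pt a' b') z)" using L by (intro up[of a b]) auto
      then show ?thesis using 2 by (simp add: mt_Pt_Eye Eye)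
    next
      case 3
      then have "Th I (Eye i j) (mt (Pt a b) z)" using L by (intro up[of a' b']) (auto intro: linked_sym)
      then have "Th I (mt (Pt a b) z) (Eye i j)" by (rule Th_sym)
      moreover have "mt (Pt a' b') z = Eye i j" using 3 by (simp add: mt_Pt_Eye Eye)
      ultimately show ?thesis by simp
    next
      case 4
      then show ?thesis using L unfolding Eye mt_Pt_Eye by (auto simp: Th_Pt intro: linked_min)
    qed
  qed
qed

text \<open>Only elements below an eye notice when it is replaced by its upper corner in a join.
  This reduces joins with collapsed eyes to joins with grid points; \<open>mt_lo\<close> does the
  same for meets.\<close>

lemma jn_hi: "jn (Pt (hi1 x) (hi2 x)) z = (if z \<preceq> x then Pt (hi1 x) (hi2 x) else jn x z)" if "mem x" "mem z"
proof (cases x)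
  case (Pt p q)
  then show ?thesis using below_antisym[of x z] by (auto simp: jn_def)
next
  case x: (Eye p q)
  then have gx: "grid (p + 1) (q + 1)" using that cell_corners by auto
  show ?thesis
  proof (cases z)
    case (Pt i j)
    then have "jn (Pt (p + 1) (q + 1)) z =
        Pt (cl (max i (p + 1)) (max j (q + 1))) (cl (max j (q + 1)) (max i (p + 1)))"
      using that gx by (simp add: jn_Pt_Pt max.commute)
    moreover have "jn x z = jn (Pt i j) (Eye p q)" by (simp add: x Pt jn_commute)
    moreover have "max i (p + 1) = p + 1" "max j (q + 1) = q + 1" if "i \<le> p \<and> j \<le> q" using that by auto
    ultimately show ?thesis using that gx by (auto simp: x Pt jn_Pt_Eye cl_grid)
  next
    case (Eye i j)
    then show ?thesis using that gx by (auto simp: x jn_def Let_def cl_grid max_def)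
  qed
qed

lemma mt_lo: "mt (Pt (lo1 x) (lo2 x)) z = (if x \<preceq> z then Pt (lo1 x) (lo2 x) else mt x z)"
  by (cases x; cases z) (auto simp: mt_def min_def)

lemma Th_jn:
  assumes I: "closed_colors I" and Th: "Th I x y" and m: "mem x" "mem y" "mem z"
  shows "Th I (jn x z) (jn y z)"
proof (cases "x = y")
  case False
  then have c: "collapsed I x" "collapsed I y" using Th by (auto simp: Th_def)
  have hi: "Th I (jn x z) (jn (Pt (hi1 x) (hi2 x)) z)" if "collapsed I x" "mem x" for x
  proof (cases "z \<preceq> x")
    case True
    then have "jn x z = x" using below_antisym[of x z] by (auto simp: jn_def)
    then show ?thesis using True that m(3) by (simp add: jn_hi Th_hi)
  qed (use that m(3) in \<open>simp add: jn_hi\<close>)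
  have "Th I (Pt (hi1 x) (hi2 x)) (Pt (hi1 y) (hi2 y))"
    using Th_trans[OF Th_sym[OF Th_hi[OF c(1)]] Th_trans[OF Th Th_hi[OF c(2)]]] .
  then have "Th I (jn (Pt (hi1 x) (hi2 x)) z) (jn (Pt (hi1 y) (hi2 y)) z)"
    using mem_bounds(2) m by (intro Th_jn_Pt[OF I]) auto
  then show ?thesis
    using hi[OF c(1) m(1)] hi[OF c(2) m(2)] Th_trans Th_sym by blast
qed simp

lemma Th_mt:
  assumes Th: "Th I x y" and m: "mem z"
  shows "Th I (mt x z) (mt y z)"
proof (cases "x = y")
  case False
  then have c: "collapsed I x" "collapsed I y" using Th by (auto simp: Th_def)
  have lo: "Th I (mt x z) (mt (Pt (lo1 x) (lo2 x)) z)" if "collapsed I x" for x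
  proof (cases "x \<preceq> z")
    case True
    then have "mt x z = x" by (auto simp: mt_def)
    then show ?thesis using True that by (simp add: mt_lo Th_lo)
  qed (simp add: mt_lo)
  have "Th I (Pt (lo1 x) (lo2 x)) (Pt (lo1 y) (lo2 y))"
    using Th_trans[OF Th_sym[OF Th_lo[OF c(1)]] Th_trans[OF Th Th_lo[OF c(2)]]] .
  then have "Th I (mt (Pt (lo1 x) (lo2 x)) z) (mt (Pt (lo1 y) (lo2 y)) z)"
    using m by (intro Th_mt_Pt) auto
  then show ?thesis
    using lo[OF c(1)] lo[OF c(2)] Th_trans Th_sym by blast
qed simp

definition congruence :: "(elem \<Rightarrow> elem \<Rightarrow> bool) \<Rightarrow> bool" where
  "congruence Q \<longleftrightarrow> (\<forall>x y. Q x y \<longrightarrow> mem x \<and> mem y) \<and> (\<forall>x. mem x \<longrightarrow> Q x x) \<and>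
     (\<forall>x y. Q x y \<longrightarrow> Q y x) \<and> (\<forall>x y z. Q x y \<longrightarrow> Q y z \<longrightarrow> Q x z) \<and>
     (\<forall>x y z w. Q x y \<longrightarrow> Q z w \<longrightarrow> Q (jn x z) (jn y w) \<and> Q (mt x z) (mt y w))"

definition Th_mem :: "'c set \<Rightarrow> elem \<Rightarrow> elem \<Rightarrow> bool" where
  "Th_mem I x y \<longleftrightarrow> mem x \<and> mem y \<and> Th I x y"

lemma congruence_Th:
  assumes "closed_colors I"
  shows "congruence (Th_mem I)"
  unfolding congruence_def Th_mem_def
proof (intro conjI allI impI; (elim conjE)?)
  fix x y z w assume m: "mem x" "mem y" "mem z" "mem w" and "Th I x y" "Th I z w"
  then show "Th I (jn x z) (jn y w)"
    using Th_trans[OF Th_jn[OF assms, of x y z]] Th_jn[OF assms, of z w y] by (simp add: jn_commute)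
  show "Th I (mt x z) (mt y w)"
    using Th_trans[OF Th_mt[of I x y z]] Th_mt[of I z w y] m \<open>Th I x y\<close> \<open>Th I z w\<close>
    by (simp add: mt_commute)
qed (auto intro: Th_sym Th_trans mem_jn mem_mt)

text \<open>The two ends of an axis edge test for a single colour; colours that do not occur on the
  axis would be invisible.\<close>

lemma subset_iff_Th_mem:
  assumes "I \<subseteq> col ` {l..<t}"
  shows "I \<subseteq> I' \<longleftrightarrow> (\<forall>x y. Th_mem I x y \<longrightarrow> Th_mem I' x y)"
proof
  assume *: "\<forall>x y. Th_mem I x y \<longrightarrow> Th_mem I' x y"
  show "I \<subseteq> I'"
  proof
    fix p assume "p \<in> I"
    then obtain i where i: "p = col i" "l \<le> i" "i < t" using assms by auto
    then have "Th_mem I (Pt i l) (Pt (i + 1) l)"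
      using \<open>p \<in> I\<close> by (simp add: Th_mem_def Th_Pt grid_axes)
    then have "Th_mem I' (Pt i l) (Pt (i + 1) l)" using * by blast
    then show "p \<in> I'" by (simp add: Th_mem_def Th_Pt i)
  qed
qed (auto simp: Th_mem_def intro: Th_mono)


section \<open>From congruences to closed sets of colours\<close>

definition edge :: "(elem \<Rightarrow> elem \<Rightarrow> bool) \<Rightarrow> int \<Rightarrow> bool" where
  "edge Q i \<longleftrightarrow> Q (Pt i l) (Pt (i + 1) l)"

text \<open>Through the reflection, \<open>edge (conj_flip Q) j\<close> speaks of the edge
  \<open>[j, j + 1]\<close> on the second axis.\<close>

definition conj_flip :: "(elem \<Rightarrow> elem \<Rightarrow> bool) \<Rightarrow> elem \<Rightarrow> elem \<Rightarrow> bool" where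
  "conj_flip Q x y = Q (flip x) (flip y)"

lemma congruenceD:
  assumes "congruence Q"
  shows congruence_mem: "Q x y \<Longrightarrow> mem x \<and> mem y"
    and congruence_refl: "mem x \<Longrightarrow> Q x x"
    and congruence_sym: "Q x y \<Longrightarrow> Q y x"
    and congruence_trans: "Q x y \<Longrightarrow> Q y z \<Longrightarrow> Q x z"
    and congruence_jn: "Q x y \<Longrightarrow> mem z \<Longrightarrow> Q (jn x z) (jn y z)"
    and congruence_mt: "Q x y \<Longrightarrow> mem z \<Longrightarrow> Q (mt x z) (mt y z)"
  using assms unfolding congruence_def by blast+

lemma congruence_jn_jn:
  "congruence Q \<Longrightarrow> Q x y \<Longrightarrow> Q z w \<Longrightarrow> Q (jn x z) (jn y w)"
  unfolding congruence_def by blast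

lemma congruence_flip:
  assumes Q: "congruence Q"
  shows "congruence (conj_flip Q)"
  unfolding congruence_def conj_flip_def jn_flip[symmetric] mt_flip[symmetric]
proof (intro conjI allI impI)
  fix x y z w assume "Q (flip x) (flip y)" "Q (flip z) (flip w)"
  then show "Q (jn (flip x) (flip z)) (jn (flip y) (flip w))"
    "Q (mt (flip x) (flip z)) (mt (flip y) (flip w))"
    using Q unfolding congruence_def by blast+
next
  fix x y assume "Q (flip x) (flip y)"
  then have "mem (flip x)" "mem (flip y)" using congruence_mem[OF Q] by blast+
  then show "mem x" "mem y" by simp_all
qed (use Q in \<open>auto intro: congruence_sym congruence_trans congruence_refl\<close>)

lemma jn_axes:
  assumes "l \<le> i" "i \<le> t" "l \<le> j" "j \<le> t"
  shows "jn (Pt i l) (Pt l j) = Pt (cl i j) (cl j i)"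
  using assms grid_axes by (simp add: jn_Pt_Pt max_absorb1 max_absorb2)

lemma mt_axis1: "grid i j \<Longrightarrow> mt (Pt i j) (Pt t l) = Pt i l"
  and mt_axis2: "grid i j \<Longrightarrow> mt (Pt i j) (Pt l t) = Pt l j"
  by (auto simp: mt_Pt_Pt grid_def)

lemma mem_axes: "l \<le> i \<Longrightarrow> i \<le> t \<Longrightarrow> mem (Pt i l)" "l \<le> i \<Longrightarrow> i \<le> t \<Longrightarrow> mem (Pt l i)"
  using grid_axes by auto

lemma l_le_t [simp]: "l \<le> t" "l < t"
  using l_neg t_nonneg by auto

text \<open>A grid point is the join of its projections to the axes, and these are its meets with
  \<open>Pt t l\<close> and \<open>Pt l t\<close>.\<close>

lemma congruence_Pt_iff:
  assumes Q: "congruence Q" and g: "grid a b" "grid i j"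
  shows "Q (Pt a b) (Pt i j) \<longleftrightarrow> Q (Pt a l) (Pt i l) \<and> Q (Pt l b) (Pt l j)"
proof
  assume *: "Q (Pt a b) (Pt i j)"
  show "Q (Pt a l) (Pt i l) \<and> Q (Pt l b) (Pt l j)"
    using congruence_mt[OF Q *, of "Pt t l"] congruence_mt[OF Q *, of "Pt l t"] g
    by (simp add: mt_axis1 mt_axis2 grid_axes)
next
  assume "Q (Pt a l) (Pt i l) \<and> Q (Pt l b) (Pt l j)"
  then have "Q (jn (Pt a l) (Pt l b)) (jn (Pt i l) (Pt l j))"
    using congruence_jn_jn[OF Q] by blast
  moreover have "jn (Pt a l) (Pt l b) = Pt a b" "jn (Pt i l) (Pt l j) = Pt i j"
    using g cl_grid[OF g(1)] cl_grid[OF g(2)] by (subst jn_axes; simp add: grid_def)+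
  ultimately show "Q (Pt a b) (Pt i j)" by simp
qed

lemma edge_between:
  assumes Q: "congruence Q" and *: "Q (Pt a l) (Pt b l)" and m: "a \<le> m" "m < b"
  shows "edge Q m"
proof -
  have "l \<le> a" "b \<le> t" using congruence_mem[OF Q *] by (auto simp: grid_def)
  then have mem: "mem (Pt m l)" "mem (Pt (m + 1) l)" using m by (auto intro!: grid_axes)
  have "Q (mt (Pt a l) (Pt (m + 1) l)) (mt (Pt b l) (Pt (m + 1) l))"
    by (rule congruence_mt[OF Q * mem(2)])
  then have "Q (Pt a l) (Pt (m + 1) l)" using m by (simp add: mt_Pt_Pt)
  then have "Q (jn (Pt a l) (Pt m l)) (jn (Pt (m + 1) l) (Pt m l))"
    by (rule congruence_jn[OF Q _ mem(1)])
  moreover have "jn (Pt a l) (Pt m l) = Pt m l" "jn (Pt (m + 1) l) (Pt m l) = Pt (m + 1) l"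
    using m by (auto simp: jn_def)
  ultimately show ?thesis by (simp add: edge_def)
qed

lemma path_of_edges:
  assumes Q: "congruence Q" and "a \<le> b" "l \<le> a" "b \<le> t" and e: "\<And>m. a \<le> m \<Longrightarrow> m < b \<Longrightarrow> edge Q m"
  shows "Q (Pt a l) (Pt b l)"
  using assms(2-5)
proof (induction rule: int_ge_induct)
  case base
  then show ?case using congruence_refl[OF Q, of "Pt a l"] grid_axes by simp
next
  case (step i)
  then have "Q (Pt a l) (Pt i l)" "edge Q i" by auto
  then show ?case unfolding edge_def by (rule congruence_trans[OF Q])
qed

lemma congruence_axis_iff:
  assumes Q: "congruence Q" and b: "l \<le> a" "a \<le> t" "l \<le> b" "b \<le> t"
  shows "Q (Pt a l) (Pt b l) \<longleftrightarrow> (\<forall>m. min a b \<le> m \<and> m < max a b \<longrightarrow> edge Q m)"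
proof (cases "a \<le> b")
  case True
  then show ?thesis
    using edge_between[OF Q, of a b] path_of_edges[OF Q True b(1,4)] by auto
next
  case False
  have "Q (Pt a l) (Pt b l) \<longleftrightarrow> Q (Pt b l) (Pt a l)" using congruence_sym[OF Q] by blast
  then show ?thesis
    using False edge_between[OF Q, of b a] path_of_edges[OF Q _ b(3,2)] by auto
qed

text \<open>Perspectivities through the middle atom of \<open>M3\<close>: the join with the eye
  moves the collapse to the eye and the upper corner, and the meet with \<open>Pt i (j + 1)\<close>
  moves it to the edge in the other direction.\<close>

lemma cell_edge:
  assumes Q: "congruence Q" and c: "cell i j" and e: "edge Q i"
  shows "edge (conj_flip Q) j"
proof -
  note g = cell_corners[OF c]
  have b: "l \<le> i" "i + 1 \<le> t" "l \<le> j" "j + 1 \<le> t" using c by (auto simp: cell_def)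
  have "Q (Pt i j) (Pt (i + 1) j)"
    using e congruence_Pt_iff[OF Q g(1,2)] congruence_refl[OF Q mem_axes(2)[of j]] b
    by (simp add: edge_def)
  then have "Q (jn (Pt i j) (Eye i j)) (jn (Pt (i + 1) j) (Eye i j))"
    using c by (intro congruence_jn[OF Q]) simp_all
  then have "Q (Eye i j) (Pt (i + 1) (j + 1))"
    using g by (simp add: jn_Pt_Eye cl_grid)
  then have "Q (mt (Eye i j) (Pt i (j + 1))) (mt (Pt (i + 1) (j + 1)) (Pt i (j + 1)))"
    using g by (intro congruence_mt[OF Q]) simp_all
  moreover have "mt (Eye i j) (Pt i (j + 1)) = Pt i j"
    by (subst mt_commute) (simp add: mt_Pt_Eye)
  ultimately have "Q (Pt i j) (Pt i (j + 1))" by (simp add: mt_Pt_Pt)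
  then have "Q (Pt l j) (Pt l (j + 1))" using congruence_Pt_iff[OF Q g(1,3)] by blast
  then show ?thesis by (simp add: edge_def conj_flip_def)
qed

lemma conj_flip_conj_flip [simp]: "conj_flip (conj_flip Q) = Q"
  by (simp add: conj_flip_def fun_eq_iff)

lemma cell_edge_iff:
  assumes Q: "congruence Q" and c: "cell i j"
  shows "edge Q i \<longleftrightarrow> edge (conj_flip Q) j"
  using cell_edge[OF Q c] cell_edge[OF congruence_flip[OF Q] c[unfolded cell_flip[of i]]] by auto

text \<open>The join with \<open>Pt l (k + 1)\<close> sends \<open>Pt (k - 1) l\<close> to column
  \<open>k - 1\<close>, but \<open>Pt k l\<close> past the missing point \<open>(k, k + 1)\<close>
  to column \<open>k + 1\<close>. Projected back to the axis, the collapse has grown by the edge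
  \<open>[k, k + 1]\<close>.\<close>

lemma fork_edge:
  assumes Q: "congruence Q" and k: "fork k" "k < t" and e: "edge Q (k - 1)"
  shows "edge Q k"
proof -
  have b: "l \<le> k - 1" "k + 1 \<le> t" using k l_neg by (auto simp: fork_def)
  have "Q (jn (Pt (k - 1) l) (Pt l (k + 1))) (jn (Pt k l) (Pt l (k + 1)))"
    using e b by (intro congruence_jn[OF Q]) (auto simp: edge_def intro!: grid_axes)
  moreover have "jn (Pt (k - 1) l) (Pt l (k + 1)) = Pt (k - 1) (k + 1)"
      "jn (Pt k l) (Pt l (k + 1)) = Pt (k + 1) (k + 1)"
    using b k by (subst jn_axes; auto simp: cl_def fork_def)+
  ultimately have *: "Q (Pt (k - 1) (k + 1)) (Pt (k + 1) (k + 1))" by simp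
  then have "grid (k - 1) (k + 1)" "grid (k + 1) (k + 1)" using congruence_mem[OF Q *] by simp_all
  then have "Q (Pt (k - 1) l) (Pt (k + 1) l)" using * congruence_Pt_iff[OF Q] by blast
  then show ?thesis by (rule edge_between[OF Q]) auto
qed

text \<open>
  The colours of the collapsed edges of negative index determine the congruence: every colour
  occurs at a negative index, and an eye links such an edge to each edge of the same colour on the
  other axis.
\<close>

lemma edge_iff_color:
  assumes Q: "congruence Q"
  defines "I \<equiv> {col j |j. l \<le> j \<and> j < 0 \<and> edge (conj_flip Q) j}"
  assumes i: "l \<le> i" "i < t"
  shows "edge Q i \<longleftrightarrow> col i \<in> I" "edge (conj_flip Q) i \<longleftrightarrow> col i \<in> I"
proof -
  have neg: "\<exists>j. l \<le> j \<and> j < 0 \<and> col j = col i" if "l \<le> i" "i < t" for i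
  proof (cases "i < 0")
    case False
    then have "col i \<in> col ` {l..<0}" using that col_nonneg by (auto simp: subset_iff)
    then show ?thesis by force
  qed (use that in auto)
  have *: "edge Q i \<longleftrightarrow> col i \<in> I" if i: "l \<le> i" "i < t" for i
  proof -
    have e: "edge Q i \<longleftrightarrow> edge (conj_flip Q) j" if "l \<le> j" "j < 0" "col j = col i" for j
      using that i t_nonneg by (intro cell_edge_iff[OF Q]) (auto simp: cell_def)
    obtain j where j: "l \<le> j" "j < 0" "col j = col i" using neg i by blast
    show ?thesis
    proof
      assume "edge Q i"
      then have "edge (conj_flip Q) j" using e[OF j] by simp
      then show "col i \<in> I" using j unfolding I_def by (auto intro!: exI[of _ j])
    next
      assume "col i \<in> I"
      then obtain k where "l \<le> k" "k < 0" "col k = col i" "edge (conj_flip Q) k"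
        unfolding I_def by force
      then show "edge Q i" using e by blast
    qed
  qed
  then show "edge Q i \<longleftrightarrow> col i \<in> I" using i by simp
  \<comment> \<open>An edge of the second axis is compared with a negative edge of the first, to
    which the first claim applies.\<close>
  obtain j where j: "l \<le> j" "j < 0" "col j = col i" using neg i by blast
  then have "edge Q j \<longleftrightarrow> edge (conj_flip Q) i"
    using i t_nonneg by (intro cell_edge_iff[OF Q]) (auto simp: cell_def)
  then show "edge (conj_flip Q) i \<longleftrightarrow> col i \<in> I"
    using *[of j] j t_nonneg by simp
qed

lemma congruence_cases_Pt:
  assumes Q: "congruence Q"
  obtains I where "I \<subseteq> col ` {l..<t}" "closed_colors I"
    "\<And>a b i j. grid a b \<Longrightarrow> grid i j \<Longrightarrow> Q (Pt a b) (Pt i j) \<longleftrightarrow> Th I (Pt a b) (Pt i j)"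
proof -
  define I where "I = {col j |j. l \<le> j \<and> j < 0 \<and> edge (conj_flip Q) j}"
  note ec = edge_iff_color[OF Q, folded I_def]
  have sub: "I \<subseteq> col ` {l..<t}" using t_nonneg by (auto simp: I_def)
  have closed: "closed_colors I"
    unfolding closed_colors_def
  proof (intro allI impI; elim conjE)
    fix k assume k: "fork k" "k < t" and c: "col (k - 1) \<in> I"
    have "l \<le> k - 1" using k l_neg by (auto simp: fork_def)
    then show "col k \<in> I"
      using ec(1)[of "k - 1"] ec(1)[of k] fork_edge[OF Q k] c k by auto
  qed
  have axis: "Q (Pt a l) (Pt b l) \<longleftrightarrow> linked col I a b" "Q (Pt l a) (Pt l b) \<longleftrightarrow> linked col I a b"
    if "l \<le> a" "a \<le> t" "l \<le> b" "b \<le> t" for a b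
  proof -
    have r: "l \<le> m \<and> m < t" if "min a b \<le> m \<and> m < max a b" for m
      using that \<open>l \<le> a\<close> \<open>a \<le> t\<close> \<open>l \<le> b\<close> \<open>b \<le> t\<close> by linarith
    show "Q (Pt a l) (Pt b l) \<longleftrightarrow> linked col I a b"
      unfolding congruence_axis_iff[OF Q that] linked_def using r ec(1) by blast
    have "Q (Pt l a) (Pt l b) \<longleftrightarrow> conj_flip Q (Pt a l) (Pt b l)" by (simp add: conj_flip_def)
    then show "Q (Pt l a) (Pt l b) \<longleftrightarrow> linked col I a b"
      unfolding congruence_axis_iff[OF congruence_flip[OF Q] that] linked_def using r ec(2) by blast
  qed
  show ?thesis
  proof (rule that[OF sub closed])
    fix a b i j assume g: "grid a b" "grid i j"
    show "Q (Pt a b) (Pt i j) \<longleftrightarrow> Th I (Pt a b) (Pt i j)"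
      unfolding congruence_Pt_iff[OF Q g] Th_Pt
      using g axis(1)[of a i] axis(2)[of b j] unfolding grid_def by blast
  qed
qed

text \<open>Meets with the upper corner, or with the eye followed by a join with the lower corner,
  push \<open>y\<close> to a corner of the cell. Collapsing the eye with either corner collapses an
  edge, and the eye transfers it to the other axis.\<close>

lemma Eye_collapse:
  assumes Q: "congruence Q" and q: "Q (Eye i j) y" and ne: "y \<noteq> Eye i j"
  shows "Q (Pt i j) (Pt (i + 1) (j + 1))"
proof -
  have c: "cell i j" and y: "mem y" using congruence_mem[OF Q q] by auto
  note g = cell_corners[OF c]
  have b: "l \<le> i" "i + 1 \<le> t" "l \<le> j" "j + 1 \<le> t" using c by (auto simp: cell_def)
  have "edge Q i \<and> edge (conj_flip Q) j"
  proof (cases "Eye i j \<preceq> y")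
    case True
    then have h: "Pt (i + 1) (j + 1) \<preceq> y" using ne by (cases y) auto
    have "Q (mt (Eye i j) (Pt (i + 1) (j + 1))) (mt y (Pt (i + 1) (j + 1)))"
      using g by (intro congruence_mt[OF Q q]) simp
    moreover have "mt (Eye i j) (Pt (i + 1) (j + 1)) = Eye i j" by (simp add: mt_def)
    moreover have "mt y (Pt (i + 1) (j + 1)) = Pt (i + 1) (j + 1)"
      using h by (subst mt_commute) (simp add: mt_def)
    ultimately have "Q (Eye i j) (Pt (i + 1) (j + 1))" by simp
    then have "Q (mt (Eye i j) (Pt i (j + 1))) (mt (Pt (i + 1) (j + 1)) (Pt i (j + 1)))"
      using g by (intro congruence_mt[OF Q]) simp_all
    moreover have "mt (Eye i j) (Pt i (j + 1)) = Pt i j"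
      by (subst mt_commute) (simp add: mt_Pt_Eye)
    ultimately have "Q (Pt i j) (Pt i (j + 1))" by (simp add: mt_Pt_Pt)
    then have "edge (conj_flip Q) j"
      using congruence_Pt_iff[OF Q g(1,3)] by (simp add: edge_def conj_flip_def)
    then show ?thesis using cell_edge_iff[OF Q c] by simp
  next
    case False
    define w where "w = mt (Eye i j) y"
    have w: "w \<preceq> Eye i j" "w \<noteq> Eye i j" using mt_lower[of "Eye i j" y] False by (auto simp: w_def)
    then have h: "w \<preceq> Pt i j" by (cases w) auto
    have "Q (mt (Eye i j) (Eye i j)) (mt y (Eye i j))" using c by (intro congruence_mt[OF Q q]) simp
    then have "Q (Eye i j) w" by (simp add: w_def mt_commute mt_def)
    then have "Q (jn (Eye i j) (Pt i j)) (jn w (Pt i j))" using g by (intro congruence_jn[OF Q]) simp_all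
    moreover have "jn (Eye i j) (Pt i j) = Eye i j" by (simp add: jn_def)
    moreover have "jn w (Pt i j) = Pt i j" using h by (simp add: jn_def)
    ultimately have "Q (Eye i j) (Pt i j)" by simp
    then have "Q (jn (Eye i j) (Pt i (j + 1))) (jn (Pt i j) (Pt i (j + 1)))"
      using g by (intro congruence_jn[OF Q]) simp_all
    moreover have "jn (Eye i j) (Pt i (j + 1)) = Pt (i + 1) (j + 1)"
      using g by (subst jn_commute) (simp add: jn_Pt_Eye cl_grid)
    moreover have "jn (Pt i j) (Pt i (j + 1)) = Pt i (j + 1)" by (simp add: jn_def)
    ultimately have "Q (Pt i (j + 1)) (Pt (i + 1) (j + 1))" using congruence_sym[OF Q] by simp
    then have "edge Q i" using congruence_Pt_iff[OF Q g(3,4)] by (simp add: edge_def)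
    then show ?thesis using cell_edge_iff[OF Q c] by simp
  qed
  then show ?thesis
    unfolding congruence_Pt_iff[OF Q g(1,4)] by (simp add: edge_def conj_flip_def)
qed

lemma Eye_lo:
  assumes Q: "congruence Q" and c: "cell i j" and q: "Q (Pt i j) (Pt (i + 1) (j + 1))"
  shows "Q (Eye i j) (Pt i j)"
proof -
  have "Q (mt (Pt i j) (Eye i j)) (mt (Pt (i + 1) (j + 1)) (Eye i j))"
    using c by (intro congruence_mt[OF Q q]) simp
  then show ?thesis using congruence_sym[OF Q] by (simp add: mt_Pt_Eye)
qed

text \<open>Eyes reduce to grid points: an eye related to another element has its cell collapsed,
  hence is related to its lower corner, and on grid points the relations agree.\<close>

theorem congruence_eq_Th:
  assumes Q: "congruence Q"
  obtains I where "I \<subseteq> col ` {l..<t}" "closed_colors I" "Q = Th_mem I"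
proof -
  obtain I where I: "I \<subseteq> col ` {l..<t}" "closed_colors I"
    and Pt: "\<And>a b i j. grid a b \<Longrightarrow> grid i j \<Longrightarrow> Q (Pt a b) (Pt i j) \<longleftrightarrow> Th I (Pt a b) (Pt i j)"
    using congruence_cases_Pt[OF Q] by blast
  have coll: "Q (Pt (lo1 x) (lo2 x)) (Pt (hi1 x) (hi2 x)) \<longleftrightarrow> collapsed I x" if "mem x" for x
    using Pt[OF mem_bounds(1,2)[OF that]] by (simp add: Th_Pt collapsed_def)
  have lo: "Q x (Pt (lo1 x) (lo2 x))" if "mem x" "collapsed I x" for x
  proof (cases x)
    case (Pt i j)
    then show ?thesis using that congruence_refl[OF Q that(1)] by simp
  next
    case (Eye i j)
    then show ?thesis using Eye_lo[OF Q, of i j] that coll[OF that(1)] by simp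
  qed
  have ne: "collapsed I x" if "Q x y" "x \<noteq> y" for x y
  proof (cases x)
    case (Pt i j)
    then show ?thesis by (simp add: collapsed_def)
  next
    case (Eye i j)
    then show ?thesis
      using Eye_collapse[OF Q, of i j y] that coll[of x] congruence_mem[OF Q that(1)] by auto
  qed
  have "Q x y \<longleftrightarrow> Th_mem I x y" for x y
  proof (cases "x = y")
    case True
    then show ?thesis using congruence_refl[OF Q] congruence_mem[OF Q] by (auto simp: Th_mem_def)
  next
    case False
    show ?thesis
    proof
      assume q: "Q x y"
      have m: "mem x" "mem y" using congruence_mem[OF Q q] by auto
      have c: "collapsed I x" "collapsed I y"
        using ne[OF q False] ne[OF congruence_sym[OF Q q]] False by auto
      have "Q (Pt (lo1 x) (lo2 x)) (Pt (lo1 y) (lo2 y))"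
        using lo[OF m(1) c(1)] lo[OF m(2) c(2)] q congruence_sym[OF Q] congruence_trans[OF Q] by blast
      then show "Th_mem I x y"
        using Pt[OF mem_bounds(1)[OF m(1)] mem_bounds(1)[OF m(2)]] c m
        by (simp add: Th_mem_def Th_Pt) (simp add: Th_def)
    next
      assume th: "Th_mem I x y"
      then have m: "mem x" "mem y" and c: "collapsed I x" "collapsed I y"
        and "Th I (Pt (lo1 x) (lo2 x)) (Pt (lo1 y) (lo2 y))"
        using False by (auto simp: Th_mem_def Th_def collapsed_def)
      then have "Q (Pt (lo1 x) (lo2 x)) (Pt (lo1 y) (lo2 y))"
        using Pt[OF mem_bounds(1)[OF m(1)] mem_bounds(1)[OF m(2)]] by blast
      then show "Q x y"
        using lo[OF m(1) c(1)] lo[OF m(2) c(2)] congruence_sym[OF Q] congruence_trans[OF Q] by blast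
    qed
  qed
  then have "Q = Th_mem I" by blast
  then show ?thesis using that I by blast
qed

lemma Th_interval:
  assumes "l \<le> u" "u \<le> v" "v \<le> t"
  shows "Th_mem I (Pt u l) (Pt v l) \<longleftrightarrow> col ` {u..<v} \<subseteq> I"
  using assms by (auto simp: Th_mem_def Th_Pt grid_axes linked_def)

end

section \<open>The lattice on natural numbers and its diagram\<close>

text \<open>Any strictly decreasing map from the integers to the open interval from 0 to 1/2 would
  serve. The bound 1/2 keeps an eye below the height of the side corners of its cell.\<close>

definition gap :: "int \<Rightarrow> real" where
  "gap i = 1 / (2 + exp (real_of_int i))"

lemma gap_bounds: "0 < gap i" "2 * gap i < 1"
  by (simp_all add: gap_def add_pos_pos divide_less_eq)

lemma gap_le_iff: "gap i \<le> gap j \<longleftrightarrow> j \<le> i"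
proof -
  have "0 < 2 + exp (real_of_int i)" "0 < 2 + exp (real_of_int j)" by (simp_all add: add_pos_pos)
  then show ?thesis by (simp add: gap_def field_simps)
qed

text \<open>
  Eyes in the same column strip (or row strip) are incomparable; letting the offsets decrease makes
  them incomparable in the plane as well.
\<close>

fun posX :: "elem \<Rightarrow> real" where
  "posX (Pt i j) = real_of_int i"
| "posX (Eye i j) = real_of_int i + gap j"

fun posY :: "elem \<Rightarrow> real" where
  "posY (Pt i j) = real_of_int j"
| "posY (Eye i j) = real_of_int j + gap i"

lemma of_int_le_gap_iff:
  "real_of_int a \<le> real_of_int i + gap k \<longleftrightarrow> a \<le> i"
  "real_of_int i + gap k \<le> real_of_int a \<longleftrightarrow> i < a"
  using gap_bounds[of k] by linarith+

lemma below_iff_pos: "x \<preceq> y \<longleftrightarrow> posX x \<le> posX y \<and> posY x \<le> posY y"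
proof (cases x)
  case (Pt i j)
  then show ?thesis by (cases y) (simp_all add: of_int_le_gap_iff)
next
  case x: (Eye i j)
  show ?thesis
  proof (cases y)
    case (Pt a b)
    then show ?thesis by (simp add: x of_int_le_gap_iff)
  next
    case (Eye a b)
    have le: "real_of_int i + gap j \<le> real_of_int a + gap b \<longleftrightarrow> i < a \<or> i = a \<and> b \<le> j" for i j a b
      using gap_bounds[of j] gap_bounds[of b] gap_le_iff[of j b] by linarith
    show ?thesis by (auto simp: x Eye le)
  qed
qed

lemma posX_bounds: "real_of_int (lo1 x) \<le> posX x" "posX x \<le> real_of_int (hi1 x)"
  and posY_bounds: "real_of_int (lo2 x) \<le> posY x" "posY x \<le> real_of_int (hi2 x)"
  using gap_bounds[of "lo1 x"] gap_bounds[of "lo2 x"] by (cases x; simp)+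

context fork_grid
begin

definition K :: "nat gorder" where
  "K = \<lparr>carrier = to_nat ` {x. mem x}, eq = (=), le = (\<lambda>a b. from_nat a \<preceq> from_nat b)\<rparr>"

definition drawing :: "nat \<Rightarrow> real \<times> real" where
  "drawing a = (posX (from_nat a) - posY (from_nat a), posX (from_nat a) + posY (from_nat a))"

lemma carrier_K: "a \<in> carrier K \<longleftrightarrow> (\<exists>x. mem x \<and> a = to_nat x)"
  by (auto simp: K_def)

lemma to_nat_carrier [simp]: "to_nat x \<in> carrier K \<longleftrightarrow> mem x"
  by (auto simp: K_def)

lemma ball_K: "(\<forall>a\<in>carrier K. P a) \<longleftrightarrow> (\<forall>x. mem x \<longrightarrow> P (to_nat x))"
  and bex_K: "(\<exists>a\<in>carrier K. P a) \<longleftrightarrow> (\<exists>x. mem x \<and> P (to_nat x))"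
  by (auto simp: K_def)

lemma le_K [simp]: "to_nat x \<sqsubseteq>\<^bsub>K\<^esub> to_nat y \<longleftrightarrow> x \<preceq> y"
  by (simp add: K_def)

lemma eq_K: "a .=\<^bsub>K\<^esub> b \<longleftrightarrow> a = b"
  by (simp add: K_def)

lemma partial_order_K: "partial_order K"
proof
  show "(.=\<^bsub>K\<^esub>) = (=)" by (simp add: K_def)
qed (auto simp: carrier_K eq_K intro: below_antisym below_trans)

lemma least_K: "mem x \<Longrightarrow> mem y \<Longrightarrow> least K (to_nat (jn x y)) (Upper K {to_nat x, to_nat y})"
  by (rule least_UpperI2) (auto simp: carrier_K mem_jn jn_upper intro: jn_least)

lemma greatest_K: "mem x \<Longrightarrow> mem y \<Longrightarrow> greatest K (to_nat (mt x y)) (Lower K {to_nat x, to_nat y})"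
  by (rule greatest_LowerI2) (auto simp: carrier_K mem_mt mt_lower intro: mt_greatest)

lemma join_K: "mem x \<Longrightarrow> mem y \<Longrightarrow> to_nat x \<squnion>\<^bsub>K\<^esub> to_nat y = to_nat (jn x y)"
  and meet_K: "mem x \<Longrightarrow> mem y \<Longrightarrow> to_nat x \<sqinter>\<^bsub>K\<^esub> to_nat y = to_nat (mt x y)"
  using partial_order.join_eq_least[OF partial_order_K least_K]
    partial_order.meet_eq_greatest[OF partial_order_K greatest_K] by blast+

lemma lattice_K: "lattice K"
proof -
  interpret partial_order K by (rule partial_order_K)
  show ?thesis
    by unfold_locales (auto simp: carrier_K intro!: least_K greatest_K)
qed

lemma below_top: "mem x \<Longrightarrow> x \<preceq> Pt t t" and above_bottom: "mem x \<Longrightarrow> Pt l l \<preceq> x"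
  using mem_bounds[of x] by (auto simp: below_def)

lemma grid_extreme [simp]: "grid l l" "grid t t" "grid l t" "grid t l"
  by (simp_all add: grid_axes) (simp add: grid_def)

lemma bottom_K: "\<bottom>\<^bsub>K\<^esub> = to_nat (Pt l l)"
  by (rule partial_order.bottom_eqI[OF partial_order_K]) (auto simp: carrier_K above_bottom)

lemma top_K: "\<top>\<^bsub>K\<^esub> = to_nat (Pt t t)"
  by (rule partial_order.top_eqI[OF partial_order_K]) (auto simp: carrier_K below_top)

lemma covered_by_K: "covered_by K (to_nat x) (to_nat y) \<longleftrightarrow> covers x y"
  unfolding covered_by_def covers_def lless_def bex_K by (simp add: eq_K) blast

lemma semimodular_K: "semimodular K"
  by (simp add: semimodular_def ball_K covered_by_K join_K meet_K upper_semimodular)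

lemma planar_K: "planar_diagram K drawing"
  unfolding drawing_def
  by (rule planar_diagram_of_embedding[OF lattice_K]) (auto simp: carrier_K simp flip: below_iff_pos)

lemma drawing_to_nat: "drawing (to_nat x) = (posX x - posY x, posX x + posY x)"
  by (simp add: drawing_def)

text \<open>The strip is convex, so only the elements need checking. Its borders pass through the
  drawings of \<open>Pt l t\<close> and \<open>Pt t l\<close>, which therefore lie on the
  boundaries.\<close>

lemma diagram_points_bounds:
  assumes "q \<in> diagram_points K drawing"
  shows "real_of_int (l - t) \<le> fst q" "fst q \<le> real_of_int (t - l)"
proof -
  let ?S = "{real_of_int (l - t)..real_of_int (t - l)} \<times> (UNIV :: real set)"
  have pt: "drawing a \<in> ?S" if a: "a \<in> carrier K" for a
  proof -
    obtain x where x: "mem x" "a = to_nat x" using a unfolding carrier_K by blast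
    have "real_of_int l \<le> posX x" "posX x \<le> real_of_int t" "real_of_int l \<le> posY x" "posY x \<le> real_of_int t"
      using mem_bounds(3-6)[OF x(1)] posX_bounds[of x] posY_bounds[of x] by linarith+
    then show ?thesis by (simp add: x drawing_to_nat)
  qed
  have "convex ?S" by (intro convex_Times convex_real_interval convex_UNIV)
  moreover have "a \<in> carrier K \<and> b \<in> carrier K" if "covered_by K a b" for a b
    using that by (auto simp: covered_by_def)
  ultimately have "closed_segment (drawing a) (drawing b) \<subseteq> ?S" if "covered_by K a b" for a b
    using that pt by (meson closed_segment_subset)
  then have "q \<in> ?S" using assms pt unfolding diagram_points_def by blast
  then show "real_of_int (l - t) \<le> fst q" "fst q \<le> real_of_int (t - l)" by auto
qed

subsection \<open>Corners\<close>

lemma join_irreducible_K: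
  "join_irreducible K (to_nat x) \<longleftrightarrow> mem x \<and> x \<noteq> Pt l l \<and>
     (\<forall>b c. mem b \<and> mem c \<and> x = jn b c \<longrightarrow> x = b \<or> x = c)"
  unfolding join_irreducible_def ball_K by (auto simp: bottom_K join_K)

lemma meet_irreducible_K:
  "meet_irreducible K (to_nat x) \<longleftrightarrow> mem x \<and> x \<noteq> Pt t t \<and>
     (\<forall>b c. mem b \<and> mem c \<and> x = mt b c \<longrightarrow> x = b \<or> x = c)"
  unfolding meet_irreducible_def ball_K by (auto simp: top_K meet_K)

text \<open>The elements below each of these two points form a chain along a side of the diagram,
  and so do those above; no eye is among them. Hence both points are doubly irreducible.\<close>

lemma corner_comparable:
  assumes "x = Pt l t \<or> x = Pt t l" "mem b" "mem c"
    and "b \<preceq> x \<and> c \<preceq> x \<or> x \<preceq> b \<and> x \<preceq> c"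
  shows "b \<preceq> c \<or> c \<preceq> b"
proof -
  have 1: "\<exists>j. b = Pt l j" if "mem b" "b \<preceq> Pt l t" for b
    using that mem_bounds(3-6)[OF that(1)] by (cases b) auto
  have 2: "\<exists>j. b = Pt j t" if "mem b" "Pt l t \<preceq> b" for b
    using that mem_bounds(3-6)[OF that(1)] by (cases b) auto
  have 3: "\<exists>j. b = Pt j l" if "mem b" "b \<preceq> Pt t l" for b
    using that mem_bounds(3-6)[OF that(1)] by (cases b) auto
  have 4: "\<exists>j. b = Pt t j" if "mem b" "Pt t l \<preceq> b" for b
    using that mem_bounds(3-6)[OF that(1)] by (cases b) auto
  show ?thesis
    using assms(1,4) 1[OF assms(2)] 1[OF assms(3)] 2[OF assms(2)] 2[OF assms(3)]
      3[OF assms(2)] 3[OF assms(3)] 4[OF assms(2)] 4[OF assms(3)]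
    by (elim disjE conjE) fastforce+
qed

lemma corner_irreducible:
  assumes "x = Pt l t \<or> x = Pt t l"
  shows "join_irreducible K (to_nat x)" "meet_irreducible K (to_nat x)"
proof -
  have m: "mem x" using assms by auto
  show "join_irreducible K (to_nat x)"
    unfolding join_irreducible_K
  proof (intro conjI allI impI)
    fix b c assume *: "mem b \<and> mem c \<and> x = jn b c"
    then have "b \<preceq> c \<or> c \<preceq> b" using corner_comparable[OF assms, of b c] jn_upper(1)[of b c] jn_upper(2)[of c b] by metis
    then show "x = b \<or> x = c" using * by (auto simp: jn_def split: if_splits)
  qed (use m assms less_imp_neq[OF l_le_t(2)] in auto)
  show "meet_irreducible K (to_nat x)"
    unfolding meet_irreducible_K
  proof (intro conjI allI impI)
    fix b c assume *: "mem b \<and> mem c \<and> x = mt b c"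
    then have "b \<preceq> c \<or> c \<preceq> b" using corner_comparable[OF assms, of b c] mt_lower[of b c] by metis
    then show "x = b \<or> x = c" using * by (auto simp: mt_def split: if_splits)
  qed (use m assms less_imp_neq[OF l_le_t(2)] in auto)
qed

text \<open>A grid point off the axes is the join of its projections. An inner point of an axis is
  the meet of the end of that axis with its neighbour across, which was not deleted because
  \<open>l + 1\<close> is not positive.\<close>

lemma doubly_irreducible_cases:
  assumes "join_irreducible K (to_nat x)" "meet_irreducible K (to_nat x)"
  obtains "x = Pt l t" | "x = Pt t l" | i j where "x = Eye i j" "cell i j"
proof (cases x)
  case (Eye i j)
  then show ?thesis using assms that by (auto simp: join_irreducible_K)
next
  case (Pt i j)
  have J: "x = b \<or> x = c" if "mem b" "mem c" "x = jn b c" for b c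
    using assms that by (auto simp: join_irreducible_K)
  have M: "x = b \<or> x = c" if "mem b" "mem c" "x = mt b c" for b c
    using assms that by (auto simp: meet_irreducible_K)
  have ne: "x \<noteq> Pt l l" "x \<noteq> Pt t t" and g: "grid i j"
    using assms Pt by (auto simp: join_irreducible_K meet_irreducible_K)
  then have b: "l \<le> i" "i \<le> t" "l \<le> j" "j \<le> t" by (auto simp: grid_def)
  have "i = l \<or> j = l"
    using J[of "Pt i l" "Pt l j"] b cl_grid[OF g] Pt by (auto simp: jn_axes grid_axes)
  then show ?thesis
  proof
    assume i: "i = l"
    have "j = t"
    proof (rule ccontr)
      assume "j \<noteq> t"
      then have "l < j" "j < t" using ne i b Pt by auto
      then have "mem (Pt (l + 1) j)" using l_neg l_le_t by (auto simp: grid_def fork_def)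
      moreover have "x = mt (Pt l t) (Pt (l + 1) j)" using Pt i b by (simp add: mt_Pt_Pt)
      ultimately have "x = Pt l t \<or> x = Pt (l + 1) j" by (intro M) simp_all
      then show False using Pt i \<open>j < t\<close> by simp
    qed
    then show ?thesis using that i Pt by blast
  next
    assume j: "j = l"
    have "i = t"
    proof (rule ccontr)
      assume "i \<noteq> t"
      then have "l < i" "i < t" using ne j b Pt by auto
      then have "mem (Pt i (l + 1))" using l_neg l_le_t by (auto simp: grid_def fork_def)
      moreover have "x = mt (Pt t l) (Pt i (l + 1))" using Pt j b by (simp add: mt_Pt_Pt)
      ultimately have "x = Pt t l \<or> x = Pt i (l + 1)" by (intro M) simp_all
      then show False using Pt j \<open>i < t\<close> by simp
    qed
    then show ?thesis using that j Pt by blast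
  qed
qed

text \<open>Eyes are doubly irreducible, so only their position excludes them as corners: at the
  height of an eye the two lower sides of its cell pass strictly to its left and right.\<close>

lemma Eye_not_boundary:
  assumes c: "cell i j"
  shows "to_nat (Eye i j) \<notin> left_boundary K drawing" "to_nat (Eye i j) \<notin> right_boundary K drawing"
proof -
  note g = cell_corners[OF c]
  have b: "i < t" "j < t" using c by (auto simp: cell_def)
  \<comment> \<open>The eye is drawn \<open>gap i + gap j\<close> higher than its lower corner, and
    each lower side rises by 1, so \<open>s\<close> is the parameter at which the sides reach the
    eye's height.\<close>
  define s where "s = gap i + gap j"
  have s: "0 \<le> s" "s \<le> 1" using gap_bounds[of i] gap_bounds[of j] by (auto simp: s_def)
  have seg: "drawing (to_nat (Pt i j)) + s *\<^sub>R (drawing (to_nat y) - drawing (to_nat (Pt i j))) \<in> diagram_points K drawing"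
    if "covers (Pt i j) y" for y
  proof -
    have "covered_by K (to_nat (Pt i j)) (to_nat y)" using that by (simp add: covered_by_K)
    moreover have "drawing (to_nat (Pt i j)) + s *\<^sub>R (drawing (to_nat y) - drawing (to_nat (Pt i j)))
        \<in> closed_segment (drawing (to_nat (Pt i j))) (drawing (to_nat y))"
      using s unfolding in_segment by (intro exI[of _ s]) (simp add: algebra_simps)
    ultimately show ?thesis unfolding diagram_points_def by blast
  qed
  have "covers (Pt i j) (Pt i (j + 1))" "covers (Pt i j) (Pt (i + 1) j)"
    using covers_left[OF g(1) b(2)] covers_right[OF g(1) b(1)] cl_grid[OF g(2)] cl_grid[OF g(3)]
    by simp_all
  from this[THEN seg] have
    q: "(i - (j + s), i + j + s) \<in> diagram_points K drawing" "(i + s - j, i + j + s) \<in> diagram_points K drawing"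
    by (simp_all add: drawing_to_nat algebra_simps)
  show "to_nat (Eye i j) \<notin> left_boundary K drawing"
    using q(1) gap_bounds[of j] by (force simp: left_boundary_def drawing_to_nat s_def)
  show "to_nat (Eye i j) \<notin> right_boundary K drawing"
    using q(2) gap_bounds[of i] by (force simp: right_boundary_def drawing_to_nat s_def)
qed

lemma left_corner_K: "left_corner K drawing a \<longleftrightarrow> a = to_nat (Pt l t)"
proof
  assume L: "left_corner K drawing a"
  then obtain x :: elem where a: "a = to_nat x" by (auto simp: left_corner_def carrier_K)
  have bd: "to_nat x \<in> left_boundary K drawing"
    and "join_irreducible K (to_nat x)" "meet_irreducible K (to_nat x)"
    using L by (auto simp: left_corner_def a)
  from this(2,3) consider "x = Pt l t" | "x = Pt t l" | i j where "x = Eye i j" "cell i j"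
    by (rule doubly_irreducible_cases)
  then show "a = to_nat (Pt l t)"
  proof cases
    case 2
    have "drawing (to_nat (Pt l t)) \<in> diagram_points K drawing" by (auto simp: diagram_points_def)
    then have "t - l \<le> l - t" using bd by (force simp: left_boundary_def drawing_to_nat 2)
    then show ?thesis using l_le_t(2) by simp
  qed (use Eye_not_boundary bd a in auto)
next
  assume a: "a = to_nat (Pt l t)"
  have "to_nat (Pt l t) \<in> left_boundary K drawing"
    using diagram_points_bounds(1) by (auto simp: left_boundary_def drawing_to_nat)
  then show "left_corner K drawing a"
    using corner_irreducible[of "Pt l t"] less_imp_neq[OF l_le_t(2)]
    by (auto simp: left_corner_def a bottom_K top_K)
qed

lemma right_corner_K: "right_corner K drawing a \<longleftrightarrow> a = to_nat (Pt t l)"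
proof
  assume L: "right_corner K drawing a"
  then obtain x :: elem where a: "a = to_nat x" by (auto simp: right_corner_def carrier_K)
  have bd: "to_nat x \<in> right_boundary K drawing"
    and "join_irreducible K (to_nat x)" "meet_irreducible K (to_nat x)"
    using L by (auto simp: right_corner_def a)
  from this(2,3) consider "x = Pt l t" | "x = Pt t l" | i j where "x = Eye i j" "cell i j"
    by (rule doubly_irreducible_cases)
  then show "a = to_nat (Pt t l)"
  proof cases
    case 1
    have "drawing (to_nat (Pt t l)) \<in> diagram_points K drawing" by (auto simp: diagram_points_def)
    then have "t - l \<le> l - t" using bd by (force simp: right_boundary_def drawing_to_nat 1)
    then show ?thesis using l_le_t(2) by simp
  qed (use Eye_not_boundary bd a in auto)
next
  assume a: "a = to_nat (Pt t l)"
  have "to_nat (Pt t l) \<in> right_boundary K drawing"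
    using diagram_points_bounds(2) by (auto simp: right_boundary_def drawing_to_nat)
  then show "right_corner K drawing a"
    using corner_irreducible[of "Pt t l"] less_imp_neq[OF l_le_t(2)]
    by (auto simp: right_corner_def a bottom_K top_K)
qed

theorem rectangular_K: "rectangular_lattice K drawing"
proof -
  have "finite_lattice K"
    unfolding finite_lattice_def
  proof (intro conjI)
    show "finite (carrier K)" using finite_mem by (simp add: K_def)
    have "to_nat (Pt l l) \<in> carrier K" by simp
    then show "carrier K \<noteq> {}" by blast
  qed (rule lattice_K)
  moreover have "lc K drawing = to_nat (Pt l t)" "rc K drawing = to_nat (Pt t l)"
    by (simp_all add: lc_def rc_def left_corner_K right_corner_K)
  moreover have "jn (Pt l t) (Pt t l) = Pt t t" "mt (Pt l t) (Pt t l) = Pt l l"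
    using l_le_t by (auto simp: jn_def mt_def cl_def max_def min_def simp del: l_le_t)
  ultimately show ?thesis
    using planar_K semimodular_K
    by (auto simp: rectangular_lattice_def left_corner_K right_corner_K join_K meet_K top_K bottom_K)
qed

subsection \<open>The congruence lattice\<close>

definition con_of :: "'c set \<Rightarrow> (nat \<times> nat) set" where
  "con_of I = {(to_nat x, to_nat y) | x y. Th_mem I x y}"

lemma con_of_iff [simp]: "(to_nat x, to_nat y) \<in> con_of I \<longleftrightarrow> Th_mem I x y"
  by (auto simp: con_of_def)

lemma lattice_congruence_con_of:
  assumes "closed_colors I"
  shows "lattice_congruence K (con_of I)"
proof -
  note Q = congruence_Th[OF assms]
  have "equiv (carrier K) (con_of I)"
  proof (rule equivI)
    show "con_of I \<subseteq> carrier K \<times> carrier K" using congruence_mem[OF Q] by (auto simp: con_of_def)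
    show "refl_on (carrier K) (con_of I)"
      using congruence_refl[OF Q] by (auto simp: refl_on_def carrier_K)
    show "sym (con_of I)" using congruence_sym[OF Q] by (auto simp: sym_def con_of_def)
    show "trans (con_of I)" using congruence_trans[OF Q] by (fastforce simp: trans_def con_of_def)
  qed
  moreover have "(a \<squnion>\<^bsub>K\<^esub> c, b \<squnion>\<^bsub>K\<^esub> d) \<in> con_of I \<and> (a \<sqinter>\<^bsub>K\<^esub> c, b \<sqinter>\<^bsub>K\<^esub> d) \<in> con_of I"
    if ab: "(a, b) \<in> con_of I" and cd: "(c, d) \<in> con_of I" for a b c d
  proof -
    obtain x y z w where e: "a = to_nat x" "b = to_nat y" "c = to_nat z" "d = to_nat w"
      and T: "Th_mem I x y" "Th_mem I z w"
      using ab cd by (auto simp: con_of_def)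
    then have "mem x" "mem y" "mem z" "mem w" using congruence_mem[OF Q] by blast+
    moreover have "Th_mem I (jn x z) (jn y w)" "Th_mem I (mt x z) (mt y w)"
      using Q T unfolding congruence_def by blast+
    ultimately show ?thesis by (simp add: e join_K meet_K)
  qed
  ultimately show ?thesis unfolding lattice_congruence_def by blast
qed

lemma lattice_congruence_eq_con_of:
  assumes "lattice_congruence K \<theta>"
  obtains I where "I \<subseteq> col ` {l..<t}" "closed_colors I" "\<theta> = con_of I"
proof -
  define Q where "Q x y \<longleftrightarrow> (to_nat x, to_nat y) \<in> \<theta>" for x y :: elem
  have eq: "equiv (carrier K) \<theta>"
    and comp: "\<And>a b c d. (a, b) \<in> \<theta> \<Longrightarrow> (c, d) \<in> \<theta> \<Longrightarrow> (a \<squnion>\<^bsub>K\<^esub> c, b \<squnion>\<^bsub>K\<^esub> d) \<in> \<theta> \<and> (a \<sqinter>\<^bsub>K\<^esub> c, b \<sqinter>\<^bsub>K\<^esub> d) \<in> \<theta>"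
    using assms unfolding lattice_congruence_def by blast+
  have sub: "\<theta> \<subseteq> carrier K \<times> carrier K" using eq by (rule equivE)
  have mem: "mem x \<and> mem y" if "Q x y" for x y
    using sub that to_nat_carrier unfolding Q_def by blast
  have "congruence Q"
    unfolding congruence_def
  proof (intro conjI allI impI)
    fix x assume "mem x"
    then show "Q x x" using eq unfolding Q_def by (auto elim!: equivE simp: refl_on_def)
  next
    fix x y assume "Q x y"
    then show "Q y x" using eq unfolding Q_def by (auto elim!: equivE dest: symD)
  next
    fix x y z assume "Q x y" "Q y z"
    then show "Q x z" using eq unfolding Q_def by (auto elim!: equivE dest: transD)
  next
    fix x y z w assume "Q x y" "Q z w"
    then show "Q (jn x z) (jn y w)" "Q (mt x z) (mt y w)"
      using comp[of "to_nat x" "to_nat y" "to_nat z" "to_nat w"] mem[of x y] mem[of z w]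
      by (simp_all add: Q_def join_K meet_K)
  qed (use mem in blast)+
  then obtain I where I: "I \<subseteq> col ` {l..<t}" "closed_colors I" "Q = Th_mem I"
    by (rule congruence_eq_Th)
  have "\<theta> = con_of I"
  proof
    show "\<theta> \<subseteq> con_of I"
    proof (rule subrelI)
      fix a b assume ab: "(a, b) \<in> \<theta>"
      then have "a \<in> carrier K" "b \<in> carrier K" using sub by auto
      then obtain x y where xy: "a = to_nat x" "b = to_nat y" "mem x" "mem y"
        unfolding carrier_K by blast
      then have "Q x y" using ab by (simp add: Q_def)
      then show "(a, b) \<in> con_of I" by (simp add: xy I(3))
    qed
    show "con_of I \<subseteq> \<theta>" by (auto simp: con_of_def Q_def simp flip: I(3))
  qed
  then show ?thesis using that I by blast
qed

lemma con_of_subset_iff: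
  assumes "I \<subseteq> col ` {l..<t}"
  shows "con_of I \<subseteq> con_of I' \<longleftrightarrow> I \<subseteq> I'"
proof -
  have "con_of I \<subseteq> con_of I' \<longleftrightarrow> (\<forall>x y. Th_mem I x y \<longrightarrow> Th_mem I' x y)"
  proof (intro iffI allI impI)
    fix x y assume "con_of I \<subseteq> con_of I'" "Th_mem I x y"
    then show "Th_mem I' x y" unfolding con_of_iff[symmetric] by blast
  next
    assume "\<forall>x y. Th_mem I x y \<longrightarrow> Th_mem I' x y"
    then show "con_of I \<subseteq> con_of I'" unfolding con_of_def by blast
  qed
  then show ?thesis using subset_iff_Th_mem[OF assms] by blast
qed

text \<open>Minimality comes from the classification: a congruence containing the pair is some
  \<open>con_of I'\<close>, and \<open>I'\<close> contains every colour between \<open>u\<close> and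
  \<open>v\<close>.\<close>

lemma principal_con_of:
  assumes "closed_colors I" and b: "l \<le> u" "u \<le> v" "v \<le> t" and I: "I = col ` {u..<v}"
  shows "principal_congruence K (con_of I)"
proof -
  have "con_of I = con K (to_nat (Pt u l)) (to_nat (Pt v l))"
  proof
    show "con K (to_nat (Pt u l)) (to_nat (Pt v l)) \<subseteq> con_of I"
      using lattice_congruence_con_of[OF assms(1)] Th_interval[OF b] I by (auto simp: con_def)
    show "con_of I \<subseteq> con K (to_nat (Pt u l)) (to_nat (Pt v l))"
      unfolding con_def
    proof (rule Inter_greatest; elim CollectE conjE)
      fix \<theta> assume "lattice_congruence K \<theta>" and in': "(to_nat (Pt u l), to_nat (Pt v l)) \<in> \<theta>"
      then obtain I' where "\<theta> = con_of I'" using lattice_congruence_eq_con_of by metis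
      then have "I \<subseteq> I'" using in' Th_interval[OF b] I by simp
      moreover have "I \<subseteq> col ` {l..<t}" using I b by auto
      ultimately show "con_of I \<subseteq> \<theta>" using \<open>\<theta> = con_of I'\<close> con_of_subset_iff by blast
    qed
  qed
  moreover have "to_nat (Pt u l) \<in> carrier K" "to_nat (Pt v l) \<in> carrier K"
    using b by (simp_all add: grid_axes)
  ultimately show ?thesis
    unfolding principal_congruence_def by blast
qed

end

section \<open>Join-irreducible elements of a finite distributive lattice\<close>

lemma finite_lattice_bottom:
  assumes "finite_lattice D"
  shows "\<bottom>\<^bsub>D\<^esub> \<in> carrier D" "x \<in> carrier D \<Longrightarrow> \<bottom>\<^bsub>D\<^esub> \<sqsubseteq>\<^bsub>D\<^esub> x"
proof -
  interpret lattice D using assms by (simp add: finite_lattice_def)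
  have "greatest D (\<Sqinter>\<^bsub>D\<^esub> carrier D) (Lower D (carrier D))"
    using assms by (intro finite_inf_greatest) (auto simp: finite_lattice_def)
  then have b: "\<Sqinter>\<^bsub>D\<^esub> carrier D \<in> carrier D" "\<And>x. x \<in> carrier D \<Longrightarrow> \<Sqinter>\<^bsub>D\<^esub> carrier D \<sqsubseteq>\<^bsub>D\<^esub> x"
    by (auto simp: greatest_def Lower_def)
  then have "\<bottom>\<^bsub>D\<^esub> = \<Sqinter>\<^bsub>D\<^esub> carrier D" by (rule bottom_eqI)
  with b show "\<bottom>\<^bsub>D\<^esub> \<in> carrier D" "x \<in> carrier D \<Longrightarrow> \<bottom>\<^bsub>D\<^esub> \<sqsubseteq>\<^bsub>D\<^esub> x" by simp_all
qed

definition irreducibles :: "('a, 'b) gorder_scheme \<Rightarrow> 'a set" where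
  "irreducibles D = {p. join_irreducible D p}"

definition irr_below :: "('a, 'b) gorder_scheme \<Rightarrow> 'a \<Rightarrow> 'a set" where
  "irr_below D d = {p \<in> irreducibles D. p \<sqsubseteq>\<^bsub>D\<^esub> d}"

definition down_closed :: "('a, 'b) gorder_scheme \<Rightarrow> 'a set \<Rightarrow> bool" where
  "down_closed D I \<longleftrightarrow> I \<subseteq> irreducibles D \<and>
     (\<forall>p\<in>I. \<forall>q\<in>irreducibles D. q \<sqsubseteq>\<^bsub>D\<^esub> p \<longrightarrow> q \<in> I)"

lemma irreducibles_carrier: "p \<in> irreducibles D \<Longrightarrow> p \<in> carrier D"
  by (simp add: irreducibles_def join_irreducible_def)

lemma finite_irreducibles: "finite_lattice D \<Longrightarrow> finite (irreducibles D)"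
  by (rule finite_subset[of _ "carrier D"]) (auto simp: irreducibles_carrier finite_lattice_def)

text \<open>A minimal element among those below \<open>x\<close> but not below \<open>y\<close> is
  join-irreducible: two strictly smaller joinands would be below \<open>y\<close>, and so would
  their join.\<close>

lemma irr_separates:
  assumes D: "finite_lattice D" and xy: "x \<in> carrier D" "y \<in> carrier D" "\<not> x \<sqsubseteq>\<^bsub>D\<^esub> y"
  shows "\<exists>p\<in>irreducibles D. p \<sqsubseteq>\<^bsub>D\<^esub> x \<and> \<not> p \<sqsubseteq>\<^bsub>D\<^esub> y"
proof -
  interpret lattice D using D by (simp add: finite_lattice_def)
  have fin: "finite (carrier D)" using D by (simp add: finite_lattice_def)
  define rel where "rel = {(a, b). a \<in> carrier D \<and> b \<in> carrier D \<and> a \<sqsubseteq>\<^bsub>D\<^esub> b \<and> a \<noteq> b}"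
  have "finite rel"
    by (rule finite_subset[of _ "carrier D \<times> carrier D"]) (auto simp: rel_def fin)
  moreover have "trans rel"
    unfolding rel_def trans_def using le_trans le_antisym by blast
  then have "acyclic rel"
    by (simp add: acyclic_irrefl trancl_id irrefl_def rel_def)
  ultimately have "wf rel" by (rule finite_acyclic_wf)
  moreover have "x \<in> {z \<in> carrier D. z \<sqsubseteq>\<^bsub>D\<^esub> x \<and> \<not> z \<sqsubseteq>\<^bsub>D\<^esub> y}" using xy by simp
  ultimately obtain p where p: "p \<in> {z \<in> carrier D. z \<sqsubseteq>\<^bsub>D\<^esub> x \<and> \<not> z \<sqsubseteq>\<^bsub>D\<^esub> y}"
    and min: "\<And>z. (z, p) \<in> rel \<Longrightarrow> z \<notin> {z \<in> carrier D. z \<sqsubseteq>\<^bsub>D\<^esub> x \<and> \<not> z \<sqsubseteq>\<^bsub>D\<^esub> y}"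
    by (rule wfE_min) blast
  have small: "b \<sqsubseteq>\<^bsub>D\<^esub> y" if "b \<in> carrier D" "b \<sqsubseteq>\<^bsub>D\<^esub> p" "b \<noteq> p" for b
  proof -
    have "(b, p) \<in> rel" using that p by (simp add: rel_def)
    moreover have "b \<sqsubseteq>\<^bsub>D\<^esub> x" using le_trans[OF that(2)] that(1) p xy(1) by simp
    ultimately show ?thesis using min[of b] that(1) by blast
  qed
  have "p \<noteq> \<bottom>\<^bsub>D\<^esub>" using p finite_lattice_bottom(2)[OF D xy(2)] by auto
  moreover have "p = b \<or> p = c" if bc: "b \<in> carrier D" "c \<in> carrier D" "p = b \<squnion>\<^bsub>D\<^esub> c" for b c
  proof (rule ccontr)
    assume n: "\<not> (p = b \<or> p = c)"
    have "b \<sqsubseteq>\<^bsub>D\<^esub> y" "c \<sqsubseteq>\<^bsub>D\<^esub> y"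
      using bc n join_left[of b c] join_right[of b c] by (auto intro!: small)
    then have "p \<sqsubseteq>\<^bsub>D\<^esub> y" using bc xy by (auto intro: join_le)
    then show False using p by simp
  qed
  ultimately have "p \<in> irreducibles D" using p by (auto simp: irreducibles_def join_irreducible_def)
  then show ?thesis using p by auto
qed

lemma irr_below_subset_iff:
  assumes D: "finite_lattice D" and xy: "x \<in> carrier D" "y \<in> carrier D"
  shows "irr_below D x \<subseteq> irr_below D y \<longleftrightarrow> x \<sqsubseteq>\<^bsub>D\<^esub> y"
proof
  interpret lattice D using D by (simp add: finite_lattice_def)
  assume "x \<sqsubseteq>\<^bsub>D\<^esub> y"
  then show "irr_below D x \<subseteq> irr_below D y"
    using le_trans[OF _ _ irreducibles_carrier xy] unfolding irr_below_def by blast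
next
  assume "irr_below D x \<subseteq> irr_below D y"
  then show "x \<sqsubseteq>\<^bsub>D\<^esub> y" using irr_separates[OF D xy] by (auto simp: irr_below_def)
qed

lemma down_closed_irr_below:
  assumes D: "finite_lattice D" and x: "x \<in> carrier D"
  shows "down_closed D (irr_below D x)"
proof -
  interpret lattice D using D by (simp add: finite_lattice_def)
  have "q \<sqsubseteq>\<^bsub>D\<^esub> x" if "q \<in> irreducibles D" "p \<in> irreducibles D" "q \<sqsubseteq>\<^bsub>D\<^esub> p" "p \<sqsubseteq>\<^bsub>D\<^esub> x" for p q
    using le_trans[OF that(3,4) irreducibles_carrier irreducibles_carrier x] that(1,2) by blast
  then show ?thesis by (auto simp: down_closed_def irr_below_def)
qed

text \<open>\<open>d\<close> is the join of \<open>I\<close>, built up one element at a time from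
  the bottom. By distributivity an irreducible below a join lies below one of the joinands, so the
  join captures no irreducible outside \<open>I\<close>.\<close>

lemma down_closed_eq_irr_below:
  assumes D: "finite_lattice D" and dist: "distributive D" and I: "down_closed D I"
  obtains d where "d \<in> carrier D" "I = irr_below D d"
proof -
  interpret lattice D using D by (simp add: finite_lattice_def)
  have sub: "I \<subseteq> irreducibles D" using I by (simp add: down_closed_def)
  then have "finite I" by (rule finite_subset[OF _ finite_irreducibles[OF D]])
  then have "\<exists>d\<in>carrier D. (\<forall>p\<in>I. p \<sqsubseteq>\<^bsub>D\<^esub> d) \<and>
      (\<forall>p\<in>irreducibles D. p \<sqsubseteq>\<^bsub>D\<^esub> d \<longrightarrow> (\<exists>q\<in>I. p \<sqsubseteq>\<^bsub>D\<^esub> q))"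
    (is "\<exists>d\<in>carrier D. ?P d I")
    using sub
  proof (induction rule: finite_subset_induct')
    case empty
    have "\<not> p \<sqsubseteq>\<^bsub>D\<^esub> \<bottom>\<^bsub>D\<^esub>" if "p \<in> irreducibles D" for p
      using that finite_lattice_bottom[OF D] le_antisym[of p "\<bottom>\<^bsub>D\<^esub>"]
      by (auto simp: irreducibles_def join_irreducible_def)
    then show ?case using finite_lattice_bottom[OF D] by blast
  next
    case (insert r F)
    then obtain d where d: "d \<in> carrier D" "?P d F" by blast
    have r: "r \<in> carrier D" using insert by (simp add: irreducibles_carrier)
    have "?P (d \<squnion>\<^bsub>D\<^esub> r) (insert r F)"
    proof (intro conjI ballI impI)
      fix p assume "p \<in> insert r F"
      moreover have "p \<sqsubseteq>\<^bsub>D\<^esub> d \<squnion>\<^bsub>D\<^esub> r" if p: "p \<in> F"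
      proof -
        have "p \<in> carrier D" using p insert.hyps by (intro irreducibles_carrier) blast
        then show ?thesis using p d r le_trans[of p d "d \<squnion>\<^bsub>D\<^esub> r"] join_left[of d r] by simp
      qed
      ultimately show "p \<sqsubseteq>\<^bsub>D\<^esub> d \<squnion>\<^bsub>D\<^esub> r" using d(1) r join_right by auto
    next
      fix p assume p: "p \<in> irreducibles D" "p \<sqsubseteq>\<^bsub>D\<^esub> d \<squnion>\<^bsub>D\<^esub> r"
      have pc: "p \<in> carrier D" using p by (simp add: irreducibles_carrier)
      have "p = p \<sqinter>\<^bsub>D\<^esub> (d \<squnion>\<^bsub>D\<^esub> r)"
        using pc d(1) r p(2) by (intro le_antisym) (auto intro: meet_le meet_left)
      also have "\<dots> = (p \<sqinter>\<^bsub>D\<^esub> d) \<squnion>\<^bsub>D\<^esub> (p \<sqinter>\<^bsub>D\<^esub> r)"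
        using dist pc d(1) r by (simp add: distributive_def)
      finally have "p = p \<sqinter>\<^bsub>D\<^esub> d \<or> p = p \<sqinter>\<^bsub>D\<^esub> r"
        using p(1) meet_closed[OF pc d(1)] meet_closed[OF pc r]
        unfolding irreducibles_def join_irreducible_def by blast
      then have "p \<sqsubseteq>\<^bsub>D\<^esub> d \<or> p \<sqsubseteq>\<^bsub>D\<^esub> r"
        using meet_right[OF pc d(1)] meet_right[OF pc r] by metis
      then show "\<exists>q\<in>insert r F. p \<sqsubseteq>\<^bsub>D\<^esub> q" using d(2) p(1) by blast
    qed
    then show ?case by (rule bexI[OF _ join_closed[OF d(1) r]])
  qed
  then obtain d where d: "d \<in> carrier D" "\<And>p. p \<in> I \<Longrightarrow> p \<sqsubseteq>\<^bsub>D\<^esub> d"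
    "\<And>p. p \<in> irreducibles D \<Longrightarrow> p \<sqsubseteq>\<^bsub>D\<^esub> d \<Longrightarrow> \<exists>q\<in>I. p \<sqsubseteq>\<^bsub>D\<^esub> q"
    by blast
  have "I = irr_below D d"
    using d(2,3) I unfolding irr_below_def down_closed_def by blast
  then show ?thesis using that d(1) by blast
qed

section \<open>The colouring\<close>

text \<open>Concatenate one enumeration of each member of the family.\<close>

lemma word_with_factors:
  assumes "finite \<F>" "\<And>S. S \<in> \<F> \<Longrightarrow> finite S"
  shows "\<exists>w. set w = \<Union>\<F> \<and> (\<forall>S\<in>\<F>. \<exists>xs ys zs. w = xs @ ys @ zs \<and> set ys = S)"
  using assms
proof (induction \<F>)
  case empty
  then show ?case by simp
next
  case (insert S \<F>)
  have "\<exists>w. set w = \<Union>\<F> \<and> (\<forall>S\<in>\<F>. \<exists>xs ys zs. w = xs @ ys @ zs \<and> set ys = S)"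
    by (rule insert.IH) (simp add: insert.prems)
  then obtain w where w: "set w = \<Union>\<F>" "\<forall>T\<in>\<F>. \<exists>xs ys zs. w = xs @ ys @ zs \<and> set ys = T"
    by (elim exE conjE)
  obtain s where s: "set s = S" using finite_list[OF insert.prems[OF insertI1]] by (elim exE)
  have "\<exists>xs ys zs. s @ w = xs @ ys @ zs \<and> set ys = T" if "T \<in> insert S \<F>" for T
  proof (cases "T = S")
    case True
    then show ?thesis using s by (intro exI[of _ "[]"] exI[of _ s] exI[of _ w]) simp
  next
    case False
    then have "T \<in> \<F>" using that by simp
    with w(2) have "\<exists>xs ys zs. w = xs @ ys @ zs \<and> set ys = T" by (rule bspec)
    then obtain xs ys zs where "w = xs @ ys @ zs" "set ys = T" by (elim exE conjE)
    then show ?thesis by (intro exI[of _ "s @ xs"] exI[of _ ys] exI[of _ zs]) simp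
  qed
  then have factors: "\<forall>T\<in>insert S \<F>. \<exists>xs ys zs. s @ w = xs @ ys @ zs \<and> set ys = T" by (rule ballI)
  have "set (s @ w) = \<Union>(insert S \<F>)" using s w(1) by simp
  from conjI[OF this factors] show ?case by (rule exI)
qed

text \<open>
  Edges of negative index spell out a word having every set of colours as a factor, which makes all
  congruences principal; the edges \<open>2 k\<close> and \<open>2 k + 1\<close> carry the \<open>k\<close>-th pair of colours, the fork
  at \<open>2 k + 1\<close> forcing the first to dominate the second.
\<close>

definition coloring :: "'c list \<Rightarrow> ('c \<times> 'c) list \<Rightarrow> int \<Rightarrow> 'c" where
  "coloring w rs i = (if i < 0 then w ! nat (i + int (length w))
     else if even i then fst (rs ! nat (i div 2)) else snd (rs ! nat (i div 2)))"

text \<open>Negative indices count from the end of the word, so the place of a factor depends only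
  on its length and on what follows it.\<close>

lemma coloring_factor:
  "coloring (xs @ ys @ zs) rs ` {- int (length (ys @ zs))..<- int (length zs)} = set ys"
proof -
  have *: "coloring (xs @ ys @ zs) rs (int k - int (length (ys @ zs))) = ys ! k" if "k < length ys" for k
    using that by (auto simp: coloring_def nth_append nat_add_distrib)
  have "{- int (length (ys @ zs))..<- int (length zs)} =
      (\<lambda>k. int k - int (length (ys @ zs))) ` {..<length ys}" (is "?A = ?B")
  proof
    show "?A \<subseteq> ?B"
    proof
      fix i assume "i \<in> ?A"
      then show "i \<in> ?B" by (intro image_eqI[of _ _ "nat (i + int (length (ys @ zs)))"]) auto
    qed
  qed auto
  then have "coloring (xs @ ys @ zs) rs ` ?A = (\<lambda>k. ys ! k) ` {..<length ys}"
    using * by (simp add: image_image)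
  then show ?thesis by (auto simp: set_conv_nth)
qed

lemma coloring_pairs:
  assumes "k < length rs"
  shows "coloring w rs (2 * int k) = fst (rs ! k)" "coloring w rs (2 * int k + 1) = snd (rs ! k)"
  using assms by (simp_all add: coloring_def)

lemma coloring_nonneg:
  assumes "0 \<le> i" "i < 2 * int (length rs)"
  shows "coloring w rs i \<in> fst ` set rs \<union> snd ` set rs"
proof -
  have "nat (i div 2) < length rs" using assms by linarith
  then show ?thesis using assms by (simp add: coloring_def)
qed

theorem theorem1:
  fixes D :: "('a, 'b) gorder_scheme"
  assumes "finite_lattice D" and "distributive D"
    and nontrivial: "card (carrier D) \<ge> 2"
  shows "\<exists>(K :: nat gorder) (p :: nat \<Rightarrow> real \<times> real).
           rectangular_lattice K p \<and>
           lattice_isomorphic (Con K) D \<and>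
           (\<forall>\<theta>\<in>carrier (Con K). principal_congruence K \<theta>)"
proof -
  note D = assms(1)
  interpret D: lattice D using D by (simp add: finite_lattice_def)
  define P where "P = irreducibles D"
  have finP: "finite P"
    using finite_irreducibles[OF D] by (simp add: P_def)
  \<comment> \<open>A one-element congruence lattice would force a one-element \<open>K\<close>,
    which has no corners. Here two elements of \<open>D\<close> provide a colour, and thus
    \<open>l < 0\<close>.\<close>
  have P_ne: "P \<noteq> {}"
  proof -
    have "carrier D \<noteq> {\<bottom>\<^bsub>D\<^esub>}" using nontrivial by auto
    then obtain x where x: "x \<in> carrier D" "x \<noteq> \<bottom>\<^bsub>D\<^esub>" using finite_lattice_bottom(1)[OF D] by blast
    then have "\<not> x \<sqsubseteq>\<^bsub>D\<^esub> \<bottom>\<^bsub>D\<^esub>"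
      using finite_lattice_bottom[OF D] D.le_antisym by blast
    then show ?thesis using irr_separates[OF D x(1) finite_lattice_bottom(1)[OF D]] by (auto simp: P_def)
  qed
  have "\<exists>w. set w = \<Union>(Pow P) \<and> (\<forall>S\<in>Pow P. \<exists>xs ys zs. w = xs @ ys @ zs \<and> set ys = S)"
    using finP by (intro word_with_factors) (auto intro: finite_subset)
  then obtain w where w: "set w = \<Union>(Pow P)"
    and fac: "\<forall>S\<in>Pow P. \<exists>xs ys zs. w = xs @ ys @ zs \<and> set ys = S"
    by (elim exE conjE)
  have set_w: "set w = P" using w by simp
  \<comment> \<open>All comparable pairs are listed, not only coverings, so that closure under the
    forks is down-closure at once.\<close>
  define R where "R = {(p, q). p \<in> P \<and> q \<in> P \<and> q \<sqsubseteq>\<^bsub>D\<^esub> p}"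
  have "finite R" by (rule finite_subset[of _ "P \<times> P"]) (auto simp: R_def finP)
  then obtain rs where rs: "set rs = R" using finite_list by blast
  define col where "col = coloring w rs"
  define l t where "l = - int (length w)" and "t = 2 * int (length rs)"
  have neg: "col ` {l..<0} = P"
    using coloring_factor[of "[]" w "[]" rs] set_w by (simp add: col_def l_def)
  have nonneg: "col ` {0..<t} \<subseteq> P"
    using coloring_nonneg[of _ rs w] rs by (fastforce simp: col_def t_def R_def)
  interpret fork_grid l t col
  proof
    show "l < 0" using set_w P_ne by (auto simp: l_def)
  qed (use neg nonneg in \<open>auto simp: t_def\<close>)
  have all: "col ` {l..<t} = P"
  proof -
    have "{l..<t} = {l..<0} \<union> {0..<t}" using l_neg t_nonneg by auto
    then show ?thesis using neg nonneg by (auto simp: image_Un)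
  qed
  have closed: "closed_colors I \<longleftrightarrow> down_closed D I" if "I \<subseteq> P" for I
  proof
    assume I: "closed_colors I"
    have "q \<in> I" if "p \<in> I" "q \<in> P" "q \<sqsubseteq>\<^bsub>D\<^esub> p" for p q
    proof -
      have "(p, q) \<in> set rs" using that \<open>I \<subseteq> P\<close> by (auto simp: rs R_def)
      then obtain k where k: "k < length rs" "rs ! k = (p, q)" by (auto simp: in_set_conv_nth)
      have "fork (2 * int k + 1)" "2 * int k + 1 < t" using k by (auto simp: fork_def t_def)
      moreover have "col (2 * int k + 1 - 1) \<in> I" using coloring_pairs[OF k(1)] k that by (simp add: col_def)
      ultimately have "col (2 * int k + 1) \<in> I" using I unfolding closed_colors_def by blast
      then show ?thesis using coloring_pairs[OF k(1)] k by (simp add: col_def)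
    qed
    then show "down_closed D I" using that unfolding down_closed_def P_def by blast
  next
    assume I: "down_closed D I"
    show "closed_colors I"
      unfolding closed_colors_def
    proof (intro allI impI; elim conjE)
      fix i assume i: "fork i" "i < t" "col (i - 1) \<in> I"
      define k where "k = nat (i div 2)"
      have k: "i = 2 * int k + 1" "k < length rs" using i by (auto simp: fork_def t_def k_def elim!: oddE)
      have "rs ! k \<in> R" using k(2) rs nth_mem by blast
      then have "snd (rs ! k) \<in> P" "snd (rs ! k) \<sqsubseteq>\<^bsub>D\<^esub> fst (rs ! k)" by (auto simp: R_def)
      moreover have "fst (rs ! k) \<in> I" "col i = snd (rs ! k)"
        using coloring_pairs[OF k(2)] i(3) k(1) by (simp_all add: col_def)
      ultimately show "col i \<in> I" using I unfolding down_closed_def P_def by auto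
    qed
  qed
  define h where "h d = con_of (irr_below D d)" for d
  have sub: "irr_below D d \<subseteq> P" for d by (auto simp: irr_below_def P_def)
  have le: "h x \<subseteq> h y \<longleftrightarrow> x \<sqsubseteq>\<^bsub>D\<^esub> y" if "x \<in> carrier D" "y \<in> carrier D" for x y
    using con_of_subset_iff[of "irr_below D x" "irr_below D y"] irr_below_subset_iff[OF D that] sub
    by (simp add: h_def all)
  have cong: "\<exists>d\<in>carrier D. \<theta> = h d" if \<theta>: "lattice_congruence K \<theta>" for \<theta>
  proof -
    obtain I where I: "I \<subseteq> P" "closed_colors I" "\<theta> = con_of I"
      using lattice_congruence_eq_con_of[OF \<theta>] all by metis
    then obtain d where "d \<in> carrier D" "I = irr_below D d"
      using down_closed_eq_irr_below[OF D assms(2)] closed by metis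
    then show ?thesis using I(3) by (auto simp: h_def)
  qed
  have cl: "closed_colors (irr_below D d)" if "d \<in> carrier D" for d
    using closed[OF sub] down_closed_irr_below[OF D that] by simp
  have bij: "bij_betw h (carrier D) (carrier (Con K))"
    unfolding bij_betw_def
  proof
    show "inj_on h (carrier D)"
      using le D.le_antisym by (intro inj_onI) (metis order_refl)
    show "h ` carrier D = carrier (Con K)"
      using cong lattice_congruence_con_of[OF cl] by (auto simp: Con_def h_def)
  qed
  have "partial_order (Con K)"
    by unfold_locales (auto simp: Con_def)
  then have iso: "lattice_isomorphic (Con K) D"
    by (rule lattice_isomorphicI_order_iso[OF _ D.lattice_axioms bij]) (simp add: Con_def le)
  have princ: "principal_congruence K \<theta>" if \<theta>: "\<theta> \<in> carrier (Con K)" for \<theta>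
  proof -
    obtain d where d: "d \<in> carrier D" "\<theta> = h d" using cong \<theta> by (auto simp: Con_def)
    have "\<exists>xs ys zs. w = xs @ ys @ zs \<and> set ys = irr_below D d"
      using fac by (rule bspec) (simp add: sub)
    then obtain xs ys zs where f: "w = xs @ ys @ zs" "set ys = irr_below D d" by (elim exE conjE)
    have "irr_below D d = col ` {- int (length (ys @ zs))..<- int (length zs)}"
      using coloring_factor[of xs ys zs rs] f by (simp add: col_def)
    then show ?thesis
      unfolding d(2) h_def using t_nonneg
      by (intro principal_con_of[OF cl[OF d(1)]]) (auto simp: l_def f(1))
  qed
  show ?thesis using rectangular_K iso princ by blast
qed

end
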